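(* Let $\alpha$ be a finite measure on $(\mathbb{R},\mathscr{B}(\mathbb{R}))$ with $a:=\alpha(\mathbb{R})>0$ and $\int_{\mathbb{R}}\log(1+|x|)\,\alpha(dx)<+\infty$. Let $A$ be the distribution function of $\alpha$ and define $$g(x)=-\frac{|x|}{1+x^2}\left[\mathbb{I}_{[0,+\infty)}(x)\int_{(0,+\infty)}e^{-yx}\,dA(y^{-1})+\mathbb{I}_{(-\infty,0)}(x)\int_{(-\infty,0)}e^{-yx}\,dA(y^{-1})\right],\qquad x\in\mathbb{R}.$$ Then the characteristic function $t\mapsto\mathscr{G}_\alpha(e^{it\tilde\gamma(I)})$ of $\tilde\gamma(I)=\int_{\mathbb{R}}x\,\tilde\gamma(dx)$ is infinitely divisible, with L\'evy--Khintchine representation determined by the pair $(\gamma,G)$, where $\gamma=\int_{\mathbb{R}\setminus\{0\}}x^{-1}g(x)\,dx$ and $dG(x)=g(x)\,dx$ for every $x\in\mathbb{R}$. In particular, $\mathscr{G}_\alpha(e^{it\tilde\gamma(I)})=1$ for all $t\in\mathbb{R}$ if and only if $\alpha=a\,\delta_0$.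
   Context: $\mathscr{G}_\alpha$ is the law of the gamma process with parameter $\alpha$: a random finite measure $\tilde\gamma$ on $\mathbb{R}$ such that, for every finite measurable partition $\{B_1,\ldots,B_k\}$ of $\mathbb{R}$, $\tilde\gamma(B_1),\ldots,\tilde\gamma(B_k)$ are independent and $\tilde\gamma(B_j)$ is gamma distributed with mean and variance both equal to $\alpha(B_j)$ (shape $\alpha(B_j)$, scale $1$; a.s. $0$ if $\alpha(B_j)=0$). Under the stated log-integrability condition $\tilde\gamma(I)$ is a.s. well defined and finite. $\mathscr{G}_\alpha(e^{it\tilde\gamma(I)})$ denotes expectation under $\mathscr{G}_\alpha$. $\delta_0$ is the unit point mass at $0$. $A(x)=\alpha((-\infty,x])$, and $dA(y^{-1})$ denotes the (nonpositive) Stieltjes measure of the function $y\mapsto A(1/y)$, which is nonincreasing on $(0,+\infty)$ and on $(-\infty,0)$; thus, e.g., $-\int_{(0,+\infty)}e^{-yx}\,dA(y^{-1})=\int_{(0,+\infty)}e^{-x/u}\,\alpha(du)$, and similarly on $(-\infty,0)$. The L\'evy--Khintchine representation determined by the pair $(\gamma,G)$, with $\gamma\in\mathbb{R}$ and $G$ nondecreasing, right-continuous, $G(-\infty)=0$, $G(+\infty)<+\infty$, is $$t\mapsto\exp\left\{i\gamma t+\int_{\mathbb{R}\setminus\{0\}}\left(e^{itu}-1-\frac{itu}{1+u^2}\right)\frac{1+u^2}{u^2}\,dG(u)\right\}.$$ *)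

theory Defs
  imports "HOL-Probability.Probability"
begin

definition gamma_density :: "real \<Rightarrow> real \<Rightarrow> real" where
  "gamma_density s x = (if x > 0 then x powr (s - 1) * exp (- x) / Gamma s else 0)"

text \<open>The gamma law with scale 1; shape 0 is the unit mass at 0.\<close>

definition gamma_law :: "real \<Rightarrow> real measure" where
  "gamma_law s = (if s = 0 then return borel 0
                  else density lborel (\<lambda>x. ennreal (gamma_density s x)))"

text \<open>
  A gamma process with parameter \<open>\<alpha>\<close> is a random finite Borel measure \<open>\<xi>\<close>, defined on an
  arbitrary probability space \<open>M\<close> and measurable for the sigma-algebra generated by the
  evaluations at Borel sets. Some members of a partition may be empty.
\<close>

locale gamma_process = prob_space M for M :: "'w measure" +
  fixes \<alpha> :: "real measure" and \<xi> :: "'w \<Rightarrow> real measure"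
  assumes sets_process: "\<And>\<omega>. \<omega> \<in> space M \<Longrightarrow> sets (\<xi> \<omega>) = sets borel"
    and finite_process: "\<And>\<omega>. \<omega> \<in> space M \<Longrightarrow> finite_measure (\<xi> \<omega>)"
    and measurable_process:
      "\<And>B. B \<in> sets borel \<Longrightarrow> (\<lambda>\<omega>. measure (\<xi> \<omega>) B) \<in> borel_measurable M"
    and indep_process:
      "\<And>(k::nat) B. (\<And>j. j < k \<Longrightarrow> B j \<in> sets borel) \<Longrightarrow> disjoint_family_on B {..<k}
        \<Longrightarrow> (\<Union>j<k. B j) = UNIV
        \<Longrightarrow> indep_vars (\<lambda>_. borel) (\<lambda>j \<omega>. measure (\<xi> \<omega>) (B j)) {..<k}"
    and distr_process:
      "\<And>B. B \<in> sets borel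
        \<Longrightarrow> distr M borel (\<lambda>\<omega>. measure (\<xi> \<omega>) B) = gamma_law (measure \<alpha> B)"

definition identity_integral :: "('w \<Rightarrow> real measure) \<Rightarrow> 'w \<Rightarrow> real" where
  "identity_integral \<xi> \<omega> = (LINT x|\<xi> \<omega>. x)"

definition identity_integral_cf :: "'w measure \<Rightarrow> ('w \<Rightarrow> real measure) \<Rightarrow> real \<Rightarrow> complex" where
  "identity_integral_cf M \<xi> t = (CLINT \<omega>|M. iexp (t * identity_integral \<xi> \<omega>))"

text \<open>
  The Stieltjes measure of a bounded function \<open>F\<close> that is nondecreasing on an open interval \<open>S\<close>.
  Because \<^const>\<open>interval_measure\<close> needs a nondecreasing right-continuous function on the whole
  line, \<open>F\<close> is replaced by its right limits on \<open>S\<close> and extended by its infimum to the left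
  of \<open>S\<close> and by its supremum to the right. All the mass lies on \<open>S\<close>; for \<open>a < b\<close> in \<open>S\<close>, the
  mass of the interval \<open>(a, b]\<close> is \<open>F(b+) - F(a+)\<close>.
\<close>

definition stieltjes_measure_on :: "real set \<Rightarrow> (real \<Rightarrow> real) \<Rightarrow> real measure" where
  "stieltjes_measure_on S F =
    interval_measure (\<lambda>y. if \<exists>z\<in>S. y < z then Inf (F ` (S \<inter> {y<..})) else Sup (F ` S))"

text \<open>The integral over \<open>S\<close> of \<open>h\<close> against \<open>dF\<close>, for \<open>F\<close> bounded and nonincreasing on \<open>S\<close>;
  here \<open>dF\<close> is a nonpositive measure.\<close>

definition decreasing_stieltjes_integral ::
  "real set \<Rightarrow> (real \<Rightarrow> real) \<Rightarrow> (real \<Rightarrow> real) \<Rightarrow> real" where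
  "decreasing_stieltjes_integral S h F =
    - (LINT y:S|stieltjes_measure_on S (\<lambda>y. - F y). h y)"

definition g_density :: "real measure \<Rightarrow> real \<Rightarrow> real" where
  "g_density \<alpha> x = - (\<bar>x\<bar> / (1 + x\<^sup>2)) *
     (indicator {0..} x *
        decreasing_stieltjes_integral {0<..} (\<lambda>y. exp (- y * x)) (\<lambda>y. cdf \<alpha> (inverse y)) +
      indicator {..<0} x *
        decreasing_stieltjes_integral {..<0} (\<lambda>y. exp (- y * x)) (\<lambda>y. cdf \<alpha> (inverse y)))"

definition infinitely_divisible_cf :: "(real \<Rightarrow> complex) \<Rightarrow> bool" where
  "infinitely_divisible_cf \<phi> \<longleftrightarrow>
    (\<forall>n::nat. n \<ge> 1 \<longrightarrow> (\<exists>\<mu>. real_distribution \<mu> \<and> (\<forall>t. \<phi> t = char \<mu> t ^ n)))"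

definition levy_khintchine_representation ::
  "(real \<Rightarrow> complex) \<Rightarrow> real \<Rightarrow> (real \<Rightarrow> real) \<Rightarrow> bool" where
  "levy_khintchine_representation \<phi> \<gamma> G \<longleftrightarrow>
    mono G \<and> (\<forall>x. continuous (at_right x) G) \<and> (G \<longlongrightarrow> 0) at_bot \<and> (\<exists>l. (G \<longlongrightarrow> l) at_top) \<and>
    (\<forall>t. \<phi> t = exp (\<i> * \<gamma> * t +
       (CLINT u:UNIV - {0}|interval_measure G.
          (iexp (t * u) - 1 - \<i> * t * u / (1 + u\<^sup>2)) * ((1 + u\<^sup>2) / u\<^sup>2))))"

end

theory Submission
  imports Defs "HOL-Real_Asymp.Real_Asymp" "HOL-Complex_Analysis.Cauchy_Integral_Theorem"
begin

text \<open>
  A gamma variable of shape \<open>s\<close> satisfies \<open>E exp (- z X) = exp (- s Ln (1 + z))\<close> for \<open>Re z \<ge> 0\<close>. If \<open>f\<close>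
  takes finitely many values \<open>h\<^sub>j\<close>, on sets \<open>B\<^sub>j\<close>, then \<open>\<integral> f d\<xi> = \<Sum> h\<^sub>j \<xi>(B\<^sub>j)\<close> is a combination of
  independent gamma variables, hence \<open>E exp (- \<integral> f d\<xi>) = exp (- \<integral> Ln (1 + f) d\<alpha>)\<close>. Simple
  approximation and dominated convergence extend this identity to every Borel \<open>f\<close> with \<open>Re f \<ge> 0\<close>
  for which both sides make sense (\<open>exponential_functional\<close>). It is used twice. With \<open>f = l min(|x|, n)\<close>,
  letting \<open>n \<rightarrow> \<infinity>\<close> and then \<open>l \<rightarrow> 0\<close>, it shows that \<open>\<integral> |x| d\<xi>\<close> is almost surely finite
  (\<open>AE_integrable_identity\<close>). With \<open>f = - i t x\<close> it gives the characteristic function \<open>exp (- K(t))\<close>, where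
  \<open>K(t) = \<integral> Ln (1 - i t x) \<alpha>(dx)\<close> is called \<open>log_exponent\<close> below.

  The Levy-Khintchine form is Frullani's integral \<open>Ln (1 + z) = \<integral>\<^sub>0\<^sup>\<infinity> (1 - e\<^sup>-\<^sup>z\<^sup>s) e\<^sup>-\<^sup>s ds / s\<close> (\<open>frullani\<close>) integrated
  against \<open>\<alpha>\<close>: after the substitution \<open>x = u s\<close> and Fubini, \<open>- K(t)\<close> is the integral of \<open>e\<^sup>i\<^sup>t\<^sup>x - 1\<close>
  against the density \<open>\<rho>(x) / |x|\<close>, where \<open>\<rho>(x) = \<integral> 1(x u > 0) exp (- x / u) \<alpha>(du)\<close>
  (\<open>exponential_mixture\<close>). Undoing the Stieltjes notation shows \<open>g(x) = |x| \<rho>(x) / (1 + x\<^sup>2)\<close>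
  (\<open>g_density_eq\<close>), and the centering term of the representation cancels against \<open>\<gamma>\<close>.

  For infinite divisibility it has to be shown that \<open>exp (- c K)\<close> is a characteristic function for
  every \<open>c \<ge> 0\<close>. When \<open>x\<close> is replaced by a simple function, it is a product of rescaled gamma
  characteristic functions; the general case is a pointwise limit of these, and a pointwise limit of
  characteristic functions that is continuous at \<open>0\<close> is a characteristic function
  (\<open>pointwise_limit_of_chars\<close>). Finally, \<open>Re K(1) = \<integral> ln (1 + x\<^sup>2) / 2 d\<alpha>\<close> vanishes only if \<open>\<alpha>\<close> is
  concentrated at \<open>0\<close>.
\<close>

section \<open>Gamma variables and Frullani's integral\<close>

text \<open>
  Differentiation under the integral sign. By the mean value inequality on the convex set \<open>U\<close>, the
  bound \<open>w\<close> on the derivative dominates all difference quotients at once, and it also transports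
  integrability from the single point \<open>z0\<close> to all of \<open>U\<close>.
\<close>
lemma has_field_derivative_integral_dominated:
  fixes f f' :: "complex \<Rightarrow> 'a \<Rightarrow> complex"
  assumes "open U" "convex U" "z0 \<in> U" "z \<in> U"
    and deriv: "\<And>z x. z \<in> U \<Longrightarrow> x \<in> space M \<Longrightarrow> ((\<lambda>z. f z x) has_field_derivative f' z x) (at z)"
    and bound: "\<And>z x. z \<in> U \<Longrightarrow> x \<in> space M \<Longrightarrow> norm (f' z x) \<le> w x"
    and meas [measurable]: "\<And>z. f z \<in> borel_measurable M" "\<And>z. f' z \<in> borel_measurable M"
    and w: "integrable M w"
    and z0: "integrable M (f z0)"
  shows "integrable M (f z)"
    and "((\<lambda>z. \<integral>x. f z x \<partial>M) has_field_derivative (\<integral>x. f' z x \<partial>M)) (at z)"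
proof -
  have lip: "norm (f u x - f v x) \<le> w x * norm (u - v)" if "u \<in> U" "v \<in> U" "x \<in> space M" for u v x
    by (rule field_differentiable_bound[OF \<open>convex U\<close>, where f' = "\<lambda>z. f' z x"])
       (use that deriv bound in \<open>auto intro: has_field_derivative_at_within\<close>)
  have int: "integrable M (f u)" if "u \<in> U" for u
  proof -
    have "integrable M (\<lambda>x. f u x - f z0 x)"
      by (rule Bochner_Integration.integrable_bound[where f = "\<lambda>x. w x * norm (u - z0)"])
         (use w lip[OF \<open>u \<in> U\<close> \<open>z0 \<in> U\<close>] in \<open>auto intro!: AE_I2 intro: order_trans[OF _ abs_ge_self]\<close>)
    from Bochner_Integration.integrable_add[OF this z0] show ?thesis by simp
  qed
  show "integrable M (f z)" using int \<open>z \<in> U\<close> by blast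
  obtain e where e: "e > 0" "ball z e \<subseteq> U"
    using \<open>open U\<close> \<open>z \<in> U\<close> openE by blast
  show "((\<lambda>z. \<integral>x. f z x \<partial>M) has_field_derivative (\<integral>x. f' z x \<partial>M)) (at z)"
    unfolding DERIV_def tendsto_at_iff_sequentially comp_def
  proof (intro allI impI)
    fix h :: "nat \<Rightarrow> complex"
    assume h: "\<forall>i. h i \<in> UNIV - {0}" "h \<longlonglongrightarrow> 0"
    \<comment> \<open>The domination holds only while \<open>z + h i\<close> stays in \<open>U\<close>, hence the shift by \<open>N\<close> below.\<close>
    have ev: "\<forall>\<^sub>F i in sequentially. z + h i \<in> U"
    proof -
      have "\<forall>\<^sub>F i in sequentially. dist (h i) 0 < e" using h(2) e(1) by (rule tendstoD)
      then show ?thesis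
        by eventually_elim (use e in \<open>auto simp: dist_norm subset_iff\<close>)
    qed
    then obtain N where N: "\<And>i. i \<ge> N \<Longrightarrow> z + h i \<in> U"
      by (auto simp: eventually_sequentially)
    have "(\<lambda>i. \<integral>x. (f (z + h (i + N)) x - f z x) / h (i + N) \<partial>M) \<longlonglongrightarrow> (\<integral>x. f' z x \<partial>M)"
    proof (rule integral_dominated_convergence[where w = w])
      show "AE x in M. (\<lambda>i. (f (z + h (i + N)) x - f z x) / h (i + N)) \<longlonglongrightarrow> f' z x"
      proof (rule AE_I2)
        fix x assume "x \<in> space M"
        then have "(\<lambda>i. (f (z + h i) x - f z x) / h i) \<longlonglongrightarrow> f' z x"
          using deriv[OF \<open>z \<in> U\<close> \<open>x \<in> space M\<close>] h
          unfolding DERIV_def tendsto_at_iff_sequentially comp_def by blast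
        then show "(\<lambda>i. (f (z + h (i + N)) x - f z x) / h (i + N)) \<longlonglongrightarrow> f' z x"
          by (rule LIMSEQ_ignore_initial_segment)
      qed
      show "AE x in M. norm ((f (z + h (i + N)) x - f z x) / h (i + N)) \<le> w x" for i
      proof (rule AE_I2)
        fix x assume "x \<in> space M"
        then have "norm (f (z + h (i + N)) x - f z x) \<le> w x * norm (h (i + N))"
          using lip[OF N[of "i + N"] \<open>z \<in> U\<close>] by simp
        then show "norm ((f (z + h (i + N)) x - f z x) / h (i + N)) \<le> w x"
          using h(1) by (simp add: norm_divide divide_le_eq)
      qed
    qed (use w in simp_all)
    moreover have "(\<integral>x. (f (z + h (i + N)) x - f z x) / h (i + N) \<partial>M) =
        ((\<integral>x. f (z + h (i + N)) x \<partial>M) - (\<integral>x. f z x \<partial>M)) / h (i + N)" for i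
      using int[OF N[of "i + N"]] int[OF \<open>z \<in> U\<close>] by simp
    ultimately have "(\<lambda>i. ((\<integral>x. f (z + h (i + N)) x \<partial>M) - (\<integral>x. f z x \<partial>M)) / h (i + N))
        \<longlonglongrightarrow> (\<integral>x. f' z x \<partial>M)" by (simp only:)
    then show "(\<lambda>i. ((\<integral>x. f (z + h i) x \<partial>M) - (\<integral>x. f z x \<partial>M)) / h i) \<longlonglongrightarrow> (\<integral>x. f' z x \<partial>M)"
      by (rule LIMSEQ_offset)
  qed
qed

text \<open>
  The transforms below are needed for \<open>Re z \<ge> 0\<close> only. The larger open half-plane makes boundary
  points interior, so that complex derivatives are available there, while \<open>exp (- x / 2)\<close> still
  dominates \<open>exp (- (1 + z) x)\<close> uniformly in \<open>z\<close>.
\<close>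
definition half_plane :: "complex set" where "half_plane = {z. Re z > -1/2}"

lemma half_plane: "open half_plane" "convex half_plane" "0 \<in> half_plane"
  "z \<in> half_plane \<Longrightarrow> 1 + z \<notin> \<real>\<^sub>\<le>\<^sub>0" "Re z \<ge> 0 \<Longrightarrow> z \<in> half_plane"
  "z \<in> half_plane \<Longrightarrow> 1 + z \<noteq> 0"
  unfolding half_plane_def
  by (auto simp: open_halfspace_Re_gt convex_halfspace_Re_gt complex_nonpos_Reals_iff complex_eq_iff)

lemma constant_on_half_plane:
  assumes "\<And>z. z \<in> half_plane \<Longrightarrow> (F has_field_derivative 0) (at z)" "z \<in> half_plane"
  shows "F z = F 0"
  using has_field_derivative_zero_constant[OF half_plane(2), of F]
    assms half_plane(3) by (metis has_field_derivative_at_within)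

lemma integrable_powr_exp:
  assumes "s > 0" "c > 0"
  shows "integrable lborel (\<lambda>x::real. indicator {0<..} x * (x powr (s - 1) * exp (- c * x)))"
proof -
  have "(\<lambda>t. complex_of_real t powr (s - 1) / of_real (exp (c * t))) absolutely_integrable_on {0<..}"
    using absolutely_integrable_Gamma_integral[of "of_real s" c] assms by simp
  then have "(\<lambda>t. norm (complex_of_real t powr (s - 1) / of_real (exp (c * t)))) absolutely_integrable_on {0<..}"
    by (rule absolutely_integrable_norm[unfolded comp_def])
  then have "integrable lebesgue (\<lambda>t. indicator {0<..} t *\<^sub>R norm (complex_of_real t powr (s - 1) / of_real (exp (c * t))))"
    unfolding set_integrable_def .
  also have "(\<lambda>t. indicator {0<..} t *\<^sub>R norm (complex_of_real t powr (s - 1) / of_real (exp (c * t))))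
     = (\<lambda>x. indicator {0<..} x * (x powr (s - 1) * exp (- c * x)))"
    by (auto simp: fun_eq_iff norm_divide norm_powr_real_powr exp_minus field_simps split: split_indicator)
  finally show ?thesis
    by (subst (asm) integrable_completion) auto
qed

lemma norm_exp_half_plane_le:
  assumes "z \<in> half_plane" "x \<ge> 0"
  shows "norm (exp (- (1 + z) * of_real x)) \<le> exp (- (1/2) * x)"
proof -
  have "0 \<le> (1/2 + Re z) * x" using assms unfolding half_plane_def by (intro mult_nonneg_nonneg) auto
  then show ?thesis by (simp add: algebra_simps)
qed

lemma powr_exp_tendsto:
  fixes s :: real and z :: complex
  assumes "s > 0" "z \<in> half_plane"
  shows "((\<lambda>x. of_real (x powr s) * exp (- (1 + z) * of_real x)) \<longlongrightarrow> 0) (at_right 0)"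
    and "((\<lambda>x. of_real (x powr s) * exp (- (1 + z) * of_real x)) \<longlongrightarrow> 0) at_top"
proof -
  have le: "norm (of_real (x powr s) * exp (- (1 + z) * of_real x)) \<le> x powr s * exp (- (1/2) * x)"
    if "x > 0" for x :: real
    using norm_exp_half_plane_le[OF assms(2), of x] that by (simp add: norm_mult mult_left_mono del: norm_exp_eq_Re)
  have 1: "((\<lambda>x. x powr s * exp (- (1/2) * x)) \<longlongrightarrow> 0) (at_right 0)"
    using assms by real_asymp
  have 2: "((\<lambda>x. x powr s * exp (- (1/2) * x)) \<longlongrightarrow> 0) at_top"
    using assms by real_asymp
  show "((\<lambda>x. of_real (x powr s) * exp (- (1 + z) * of_real x)) \<longlongrightarrow> 0) (at_right 0)"
    by (rule tendsto_0_le[OF 1, of _ 1]) (use le in \<open>auto simp: eventually_at_filter abs_mult\<close>)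
  show "((\<lambda>x. of_real (x powr s) * exp (- (1 + z) * of_real x)) \<longlongrightarrow> 0) at_top"
    by (rule tendsto_0_le[OF 2, of _ 1])
       (rule eventually_mono[OF eventually_gt_at_top[of "0::real"]],
        use le in \<open>simp add: abs_mult del: norm_exp_eq_Re\<close>)
qed

text \<open>
  This is the differential equation behind the gamma transform: combined with
  \<open>has_field_derivative_gamma_moment\<close> it expresses the logarithmic derivative in \<open>z\<close> of the transform
  with exponent \<open>s - 1\<close> as \<open>- s / (1 + z)\<close>.
\<close>
lemma integral_by_parts_powr_exp:
  fixes s :: real and z :: complex
  assumes s: "s > 0" and z: "z \<in> half_plane"
  shows "(1 + z) * (\<integral>x. indicator {0<..} x *\<^sub>R (of_real (x powr s) * exp (- (1 + z) * of_real x)) \<partial>lborel)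
    = of_real s * (\<integral>x. indicator {0<..} x *\<^sub>R (of_real (x powr (s - 1)) * exp (- (1 + z) * of_real x)) \<partial>lborel)"
proof -
  let ?E = "\<lambda>r x. of_real (x powr r) * exp (- (1 + z) * of_real x)"
  have int: "integrable lborel (\<lambda>x. indicator {0<..} x *\<^sub>R ?E r x)" if "r > -1" for r :: real
    by (rule Bochner_Integration.integrable_bound[OF integrable_powr_exp[of "r + 1" "1/2"]])
       (use that norm_exp_half_plane_le[OF z] in
         \<open>auto simp: norm_mult mult_left_mono simp del: norm_exp_eq_Re split: split_indicator\<close>)
  define F where "F = (\<lambda>x. ?E s x)"
  define f where "f = (\<lambda>x. of_real s * ?E (s - 1) x - (1 + z) * ?E s x)"
  have F: "(F has_vector_derivative f x) (at x)" if "x > 0" for x :: real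
  proof -
    have 1: "((\<lambda>x. of_real (x powr s) :: complex) has_vector_derivative of_real (s * x powr (s - 1))) (at x)"
      using has_real_derivative_powr[OF that, of s]
      by (intro has_vector_derivative_of_real) (simp add: has_real_derivative_iff_has_vector_derivative)
    have 2: "((\<lambda>x. exp (- (1 + z) * of_real x)) has_vector_derivative - (1 + z) * exp (- (1 + z) * of_real x)) (at x)"
      by (rule has_vector_derivative_real_field) (auto intro!: derivative_eq_intros)
    show ?thesis unfolding F_def f_def
      by (rule has_vector_derivative_eq_rhs[OF has_vector_derivative_mult[OF 1 2]]) (simp add: algebra_simps)
  qed
  have fint: "integrable lborel (\<lambda>x. indicator {0<..} x *\<^sub>R f x)"
    using int[of s] int[of "s - 1"] s unfolding f_def
    by (auto simp: scaleR_diff_right simp flip: mult_scaleR_right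
        intro!: Bochner_Integration.integrable_diff)
  have ein: "einterval 0 \<infinity> = {0<..}" by (auto simp: einterval_def)
  have "(LBINT x=0..\<infinity>. f x) = 0 - 0"
  proof (rule interval_integral_FTC_integrable[where F = F])
    show "(F has_vector_derivative f x) (at x)" if "0 < ereal x" for x using F that by simp
    show "isCont f x" if "0 < ereal x" for x
      unfolding f_def using that by (auto intro!: continuous_intros)
    show "set_integrable lborel (einterval 0 \<infinity>) f" using fint by (simp add: set_integrable_def ein)
    show "((F \<circ> real_of_ereal) \<longlongrightarrow> 0) (at_right 0)"
      using powr_exp_tendsto(1)[OF s z] unfolding F_def zero_ereal_def by (simp add: ereal_tendsto_simps)
    show "((F \<circ> real_of_ereal) \<longlongrightarrow> 0) (at_left \<infinity>)"
      using powr_exp_tendsto(2)[OF s z] unfolding F_def by (simp add: ereal_tendsto_simps)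
  qed auto
  then have "(\<integral>x. indicator {0<..} x *\<^sub>R f x \<partial>lborel) = 0"
    by (simp add: interval_lebesgue_integral_def set_lebesgue_integral_def ein)
  moreover have "(\<integral>x. indicator {0<..} x *\<^sub>R f x \<partial>lborel)
     = of_real s * (\<integral>x. indicator {0<..} x *\<^sub>R ?E (s - 1) x \<partial>lborel)
       - (1 + z) * (\<integral>x. indicator {0<..} x *\<^sub>R ?E s x \<partial>lborel)"
    using int[of s] int[of "s - 1"] s unfolding f_def
    by (simp add: scaleR_diff_right flip: mult_scaleR_right)
  ultimately show ?thesis by simp
qed

definition gamma_moment :: "real \<Rightarrow> complex \<Rightarrow> complex" where
  "gamma_moment r z = (\<integral>x. indicator {0<..} x *\<^sub>R (of_real (x powr r) * exp (- (1 + z) * of_real x)) \<partial>lborel)"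

lemma nn_integral_gamma_density:
  assumes "s > 0"
  shows "(\<integral>\<^sup>+x. ennreal (gamma_density s x) \<partial>lborel) = 1"
proof -
  have G: "Gamma s > 0" using assms by (rule Gamma_real_pos)
  have "(\<integral>\<^sup>+x. ennreal (indicator {0..} x * x powr (s - 1) / exp x) \<partial>lborel)
      = (\<integral>\<^sup>+x. ennreal (Gamma s) * ennreal (gamma_density s x) \<partial>lborel)"
    using G by (intro nn_integral_cong)
      (auto simp: gamma_density_def exp_minus divide_inverse simp flip: ennreal_mult' split: split_indicator)
  also have "\<dots> = ennreal (Gamma s) * (\<integral>\<^sup>+x. ennreal (gamma_density s x) \<partial>lborel)"
    by (rule nn_integral_cmult) (simp add: gamma_density_def)
  finally have "ennreal (Gamma s) * (\<integral>\<^sup>+x. ennreal (gamma_density s x) \<partial>lborel) = ennreal (Gamma s) * 1"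
    using Gamma_conv_nn_integral_real[OF assms] by simp
  then show ?thesis using G by (subst (asm) ennreal_mult_cancel_left) auto
qed

lemma gamma_density_measurable [measurable]: "gamma_density s \<in> borel_measurable borel"
  unfolding gamma_density_def by measurable

lemma gamma_density_nonneg: "s > 0 \<Longrightarrow> gamma_density s x \<ge> 0"
  using Gamma_real_pos[of s] by (auto simp: gamma_density_def)

lemma real_distribution_gamma_law:
  assumes "s \<ge> 0"
  shows "real_distribution (gamma_law s)"
proof (cases "s = 0")
  case True
  then show ?thesis
    by (auto simp: gamma_law_def real_distribution_def real_distribution_axioms_def intro: prob_space_return)
next
  case False
  then have "s > 0" using assms by simp
  have "prob_space (density lborel (\<lambda>x. ennreal (gamma_density s x)))"
    using nn_integral_gamma_density[OF \<open>s > 0\<close>]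
    by (intro prob_spaceI) (simp add: emeasure_density gamma_density_def cong: nn_integral_cong)
  then show ?thesis
    using False by (simp add: gamma_law_def real_distribution_def real_distribution_axioms_def)
qed

lemma has_field_derivative_gamma_moment:
  assumes "s > 0" "z \<in> half_plane"
  shows "(gamma_moment (s - 1) has_field_derivative - gamma_moment s z) (at z)"
proof -
  let ?f = "\<lambda>r z x. indicator {0<..} x *\<^sub>R (of_real (x powr r) * exp (- (1 + z) * of_real x)) :: complex"
  have "((\<lambda>z. \<integral>x. ?f (s - 1) z x \<partial>lborel) has_field_derivative (\<integral>x. - ?f s z x \<partial>lborel)) (at z)"
  proof (rule has_field_derivative_integral_dominated(2)[OF half_plane(1,2,3) assms(2),
      where w = "\<lambda>x. indicator {0<..} x * (x powr (s + 1 - 1) * exp (- (1/2) * x))"])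
    show "((\<lambda>z. ?f (s - 1) z x) has_field_derivative - ?f s z x) (at z)" for z x
    proof (cases "x > 0")
      case True
      then have "x powr s = x powr (s - 1) * x" by (simp add: powr_diff)
      then show ?thesis by (auto intro!: derivative_eq_intros split: split_indicator)
    qed auto
    show "norm (- ?f s z x) \<le> indicator {0<..} x * (x powr (s + 1 - 1) * exp (- (1/2) * x))" if "z \<in> half_plane" for z x
      using norm_exp_half_plane_le[OF that, of x]
      by (auto simp: norm_mult mult_left_mono simp del: norm_exp_eq_Re split: split_indicator)
    show "integrable lborel (?f (s - 1) 0)"
      by (rule Bochner_Integration.integrable_bound[OF integrable_powr_exp[of "s" "1"]])
         (use assms in \<open>auto simp: norm_mult split: split_indicator\<close>)
  qed (use integrable_powr_exp[of "s + 1" "1/2"] assms in auto)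
  then show ?thesis by (simp add: gamma_moment_def[abs_def])
qed

text \<open>
  The product of the moment with \<open>exp (s Ln (1 + z))\<close> has derivative zero on the half-plane, which is
  convex. This determines the complex transform without appeal to analytic continuation.
\<close>
lemma gamma_moment_eq:
  assumes s: "s > 0" and z: "z \<in> half_plane"
  shows "gamma_moment (s - 1) z = gamma_moment (s - 1) 0 * exp (- of_real s * Ln (1 + z))"
proof -
  define F where "F = (\<lambda>z. gamma_moment (s - 1) z * exp (of_real s * Ln (1 + z)))"
  have "(F has_field_derivative 0) (at z)" if z: "z \<in> half_plane" for z
  proof -
    have ibp: "gamma_moment s z = of_real s * gamma_moment (s - 1) z / (1 + z)"
      using integral_by_parts_powr_exp[OF s z] half_plane(6)[OF z]
      by (simp add: gamma_moment_def eq_divide_eq mult.commute)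
    have "((\<lambda>z. exp (of_real s * Ln (1 + z))) has_field_derivative
        exp (of_real s * Ln (1 + z)) * (of_real s * (1 / (1 + z)))) (at z)"
      using half_plane(4)[OF z] by (auto intro!: derivative_eq_intros simp: divide_inverse)
    from DERIV_mult[OF has_field_derivative_gamma_moment[OF s z] this] show ?thesis
      unfolding F_def ibp by (rule DERIV_cong) (simp add: algebra_simps)
  qed
  from constant_on_half_plane[of F, OF this z]
  have "gamma_moment (s - 1) z * exp (of_real s * Ln (1 + z)) = gamma_moment (s - 1) 0"
    by (simp add: F_def)
  then show ?thesis by (simp add: exp_minus eq_divide_eq divide_inverse[symmetric])
qed

lemma gamma_law_transform_eq_gamma_moment:
  assumes s: "s > 0"
  shows "(\<integral>x. exp (- z * of_real x) \<partial>gamma_law s) = gamma_moment (s - 1) z / of_real (Gamma s)"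
proof -
  have "(\<integral>x. exp (- z * of_real x) \<partial>gamma_law s)
    = (\<integral>x. gamma_density s x *\<^sub>R exp (- z * of_real x) \<partial>lborel)"
    using s gamma_density_nonneg[OF s] unfolding gamma_law_def
    by (simp, subst integral_density) auto
  also have "\<dots> = (\<integral>x. (indicator {0<..} x *\<^sub>R (of_real (x powr (s - 1)) * exp (- (1 + z) * of_real x)))
      / of_real (Gamma s) \<partial>lborel)"
  proof (intro Bochner_Integration.integral_cong refl)
    fix x :: real
    have "exp (- (1 + z) * of_real x) = of_real (exp (- x)) * exp (- z * of_real x)"
      by (simp add: exp_of_real[symmetric] mult_exp_exp algebra_simps)
    then show "gamma_density s x *\<^sub>R exp (- z * of_real x)
      = (indicator {0<..} x *\<^sub>R (of_real (x powr (s - 1)) * exp (- (1 + z) * of_real x))) / of_real (Gamma s)"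
      by (simp add: gamma_density_def scaleR_conv_of_real)
  qed
  finally show ?thesis by (simp add: gamma_moment_def)
qed

lemma gamma_moment_zero:
  assumes "s > 0"
  shows "gamma_moment (s - 1) 0 = of_real (Gamma s)"
proof -
  interpret real_distribution "gamma_law s" using assms by (intro real_distribution_gamma_law) simp
  have "gamma_moment (s - 1) 0 / of_real (Gamma s) = 1"
    using gamma_law_transform_eq_gamma_moment[OF assms, of 0] prob_space by simp
  then show ?thesis using Gamma_real_pos[OF assms] by simp
qed

theorem gamma_law_exponential_transform:
  assumes s: "s \<ge> 0" and z: "z \<in> half_plane"
  shows "(\<integral>x. exp (- z * of_real x) \<partial>gamma_law s) = exp (- of_real s * Ln (1 + z))"
proof (cases "s = 0")
  case True
  then show ?thesis by (simp add: gamma_law_def integral_return)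
next
  case False
  with s have s: "s > 0" by simp
  then have "Gamma s \<noteq> 0" using Gamma_real_pos[OF s] by linarith
  then show ?thesis
    using gamma_law_transform_eq_gamma_moment[OF s] gamma_moment_eq[OF s z] gamma_moment_zero[OF s]
    by simp
qed

text \<open>
  For \<open>r = |w|\<close>, the left-hand side is at most \<open>min(r, 2) \<le> 4 r / (1 + r) \<le> 4 (1 - exp (- r))\<close>. The point
  of this form of the bound is that its right-hand side is again a Frullani integrand, with a
  nonnegative real parameter, and hence has an explicit integral.
\<close>
lemma norm_one_minus_exp_le:
  assumes "Re w \<ge> 0"
  shows "norm (1 - exp (- w)) \<le> 4 * (1 - exp (- norm w))"
proof -
  have "norm (exp (- w) - exp (- 0)) \<le> 1 * norm (w - 0)"
  proof (rule field_differentiable_bound[where f' = "\<lambda>w. - exp (- w)" and S = "{w. Re w \<ge> 0}"])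
    show "convex {w. Re w \<ge> 0}" by (rule convex_halfspace_Re_ge)
    show "((\<lambda>w. exp (- w)) has_field_derivative - exp (- w)) (at w within {w. Re w \<ge> 0})" for w :: complex
      by (auto intro!: derivative_eq_intros)
  qed (use assms in auto)
  then have 1: "norm (1 - exp (- w)) \<le> norm w" by (simp add: norm_minus_commute)
  have "norm (1 - exp (- w)) \<le> norm (1::complex) + norm (exp (- w))" by (rule norm_triangle_ineq4)
  also have "\<dots> \<le> 2" using assms by simp
  finally have 2: "norm (1 - exp (- w)) \<le> 2" .
  define r where "r = norm w"
  have r: "r \<ge> 0" by (simp add: r_def)
  have "exp (- r) \<le> 1 / (1 + r)"
    using exp_ge_add_one_self[of r] r by (simp add: exp_minus field_simps)
  then have "4 * (r / (1 + r)) \<le> 4 * (1 - exp (- r))" using r by (simp add: field_simps)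
  moreover have "min r 2 \<le> 4 * (r / (1 + r))"
  proof (cases "r \<le> 1")
    case True
    then have "r * (1 + r) \<le> r * 4" using r by (intro mult_left_mono) auto
    then show ?thesis using r by (simp add: field_simps)
  next
    case False
    then show ?thesis by (simp add: field_simps min_def)
  qed
  ultimately show ?thesis using 1 2 by (simp add: r_def)
qed

definition frullani_integrand :: "complex \<Rightarrow> real \<Rightarrow> complex" where
  "frullani_integrand z x = indicator {0<..} x *\<^sub>R ((1 - exp (- z * of_real x)) * of_real (exp (- x) / x))"

lemma frullani_integrand_measurable [measurable]: "frullani_integrand z \<in> borel_measurable borel"
  unfolding frullani_integrand_def by measurable

text \<open>
  Differentiation in \<open>z\<close> removes the singular factor \<open>1 / x\<close> and leaves the transform of the
  exponential law, \<open>1 / (1 + z)\<close>, which is the derivative of \<open>Ln (1 + z)\<close>; both sides vanish at \<open>0\<close>.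
\<close>
theorem frullani:
  assumes z: "z \<in> half_plane"
  shows "integrable lborel (frullani_integrand z)"
    and "(\<integral>x. frullani_integrand z x \<partial>lborel) = Ln (1 + z)"
proof -
  let ?f' = "\<lambda>z x. indicator {0<..} x *\<^sub>R exp (- (1 + z) * of_real x) :: complex"
  have D: "integrable lborel (frullani_integrand z)"
    "((\<lambda>z. \<integral>x. frullani_integrand z x \<partial>lborel) has_field_derivative (\<integral>x. ?f' z x \<partial>lborel)) (at z)"
    if z: "z \<in> half_plane" for z
  proof -
    have d: "((\<lambda>z. frullani_integrand z x) has_field_derivative ?f' z x) (at z)" for z x
    proof (cases "x > 0")
      case True
      have "((\<lambda>z. (1 - exp (- z * of_real x)) * of_real (exp (- x) / x)) has_field_derivative
          (of_real x * exp (- z * of_real x)) * of_real (exp (- x) / x)) (at z)"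
        by (auto intro!: derivative_eq_intros)
      also have "(of_real x * exp (- z * of_real x)) * of_real (exp (- x) / x) = exp (- z * of_real x) * exp (of_real (- x))"
        using True by (simp only: exp_of_real) simp
      also have "\<dots> = exp (- (1 + z) * of_real x)"
        by (simp add: mult_exp_exp algebra_simps)
      finally show ?thesis using True by (simp add: frullani_integrand_def)
    qed (auto simp: frullani_integrand_def)
    have b: "norm (?f' z x) \<le> indicator {0<..} x * (x powr (1 - 1) * exp (- (1/2) * x))" if "z \<in> half_plane" for z x
      using norm_exp_half_plane_le[OF that, of x]
      by (auto simp: norm_mult mult_left_mono simp del: norm_exp_eq_Re split: split_indicator)
    note dom = has_field_derivative_integral_dominated[OF half_plane(1,2,3) z,
        of lborel frullani_integrand ?f' "\<lambda>x. indicator {0<..} x * (x powr (1 - 1) * exp (- (1/2) * x))"]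
    have i0: "integrable lborel (frullani_integrand 0)" by (simp add: frullani_integrand_def[abs_def])
    have iw: "integrable lborel (\<lambda>x. indicator {0<..} x * (x powr (1 - 1) * exp (- (1/2) * x)) :: real)"
      by (rule integrable_powr_exp) auto
    show "integrable lborel (frullani_integrand z)"
      by (rule dom(1)[OF d b _ _ iw i0]) simp_all
    show "((\<lambda>z. \<integral>x. frullani_integrand z x \<partial>lborel) has_field_derivative (\<integral>x. ?f' z x \<partial>lborel)) (at z)"
      by (rule dom(2)[OF d b _ _ iw i0]) simp_all
  qed
  show "integrable lborel (frullani_integrand z)" by (rule D(1)[OF z])
  have f': "(\<integral>x. ?f' z x \<partial>lborel) = 1 / (1 + z)" if z: "z \<in> half_plane" for z
  proof -
    have "(\<integral>x. ?f' z x \<partial>lborel) = gamma_moment (1 - 1) z"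
      unfolding gamma_moment_def by (intro Bochner_Integration.integral_cong) (auto split: split_indicator)
    also have "\<dots> = gamma_moment (1 - 1) 0 * exp (- Ln (1 + z))"
      using gamma_moment_eq[of 1 z] z by simp
    also have "gamma_moment (1 - 1) 0 = 1"
      using gamma_moment_zero[of 1] by simp
    finally show ?thesis using half_plane(6)[OF z] by (simp add: exp_minus divide_inverse)
  qed
  define F where "F = (\<lambda>z. (\<integral>x. frullani_integrand z x \<partial>lborel) - Ln (1 + z))"
  have "(F has_field_derivative 0) (at z)" if z: "z \<in> half_plane" for z
  proof -
    have "((\<lambda>z. Ln (1 + z)) has_field_derivative 1 / (1 + z)) (at z)"
      using half_plane(4)[OF z] by (auto intro!: derivative_eq_intros simp: divide_inverse)
    from DERIV_diff[OF D(2)[OF z] this] show ?thesis unfolding F_def f'[OF z] by simp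
  qed
  from constant_on_half_plane[of F, OF this z] show "(\<integral>x. frullani_integrand z x \<partial>lborel) = Ln (1 + z)"
    by (simp add: F_def frullani_integrand_def)
qed

lemma frullani_real:
  assumes "c \<ge> 0"
  shows "integrable lborel (\<lambda>x::real. indicator {0<..} x * ((1 - exp (- c * x)) * (exp (- x) / x)))"
    and "(\<integral>x. indicator {0<..} x * ((1 - exp (- c * x)) * (exp (- x) / x)) \<partial>lborel) = ln (1 + c)"
proof -
  have *: "frullani_integrand (of_real c) = (\<lambda>x. of_real (indicator {0<..} x * ((1 - exp (- c * x)) * (exp (- x) / x))))"
    by (auto simp: frullani_integrand_def fun_eq_iff exp_of_real[symmetric] split: split_indicator)
  have c: "of_real c \<in> half_plane" using assms by (intro half_plane) simp
  show "integrable lborel (\<lambda>x::real. indicator {0<..} x * ((1 - exp (- c * x)) * (exp (- x) / x)))"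
    using frullani(1)[OF c] unfolding * complex_of_real_integrable_eq .
  have "complex_of_real (\<integral>x. indicator {0<..} x * ((1 - exp (- c * x)) * (exp (- x) / x)) \<partial>lborel) = Ln (of_real (1 + c))"
    using frullani(2)[OF c] unfolding * integral_complex_of_real by simp
  also have "\<dots> = of_real (ln (1 + c))" using assms by (subst Ln_of_real) auto
  finally show "(\<integral>x. indicator {0<..} x * ((1 - exp (- c * x)) * (exp (- x) / x)) \<partial>lborel) = ln (1 + c)"
    by (simp only: of_real_eq_iff)
qed

lemma norm_frullani_integrand_le:
  assumes "Re z \<ge> 0"
  shows "norm (frullani_integrand z x) \<le> 4 * (indicator {0<..} x * ((1 - exp (- norm z * x)) * (exp (- x) / x)))"
proof (cases "x > 0")
  case True
  then have "norm (1 - exp (- z * of_real x)) \<le> 4 * (1 - exp (- norm z * x))"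
    using norm_one_minus_exp_le[of "z * of_real x"] assms by (simp add: norm_mult)
  then have "norm (1 - exp (- z * of_real x)) * (exp (- x) / x) \<le> 4 * (1 - exp (- norm z * x)) * (exp (- x) / x)"
    using True by (intro mult_right_mono) auto
  moreover have "norm (frullani_integrand z x) = norm (1 - exp (- z * of_real x)) * (exp (- x) / x)"
    using True by (simp add: frullani_integrand_def norm_mult norm_divide del: norm_exp_eq_Re)
  ultimately show ?thesis using True by (simp only: mult.assoc indicator_simps greaterThan_iff mult_1)
qed (simp add: frullani_integrand_def)

text \<open>
  Logarithmic growth, inclusive of the imaginary part and of the behaviour near \<open>0\<close>. With this bound
  the integrability of \<open>ln (1 + |x|)\<close> is exactly what dominated convergence needs.
\<close>
lemma norm_Ln_le:
  assumes "Re z \<ge> 0"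
  shows "norm (Ln (1 + z)) \<le> 4 * ln (1 + norm z)"
proof -
  have z: "z \<in> half_plane" using assms by (rule half_plane)
  have "norm (Ln (1 + z)) \<le> (\<integral>x. norm (frullani_integrand z x) \<partial>lborel)"
    using integral_norm_bound[of lborel "frullani_integrand z"] frullani(2)[OF z] by simp
  also have "\<dots> \<le> (\<integral>x. 4 * (indicator {0<..} x * ((1 - exp (- norm z * x)) * (exp (- x) / x))) \<partial>lborel)"
    by (intro integral_mono integrable_norm frullani(1)[OF z] integrable_mult_right
        frullani_real(1) norm_ge_zero norm_frullani_integrand_le assms)
  also have "\<dots> = 4 * ln (1 + norm z)"
    by (simp only: Bochner_Integration.integral_mult_right_zero frullani_real(2) norm_ge_zero)
  finally show ?thesis .
qed

section \<open>Products and limits of characteristic functions\<close>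

lemma exists_real_distribution_prod_char:
  fixes N :: "'i \<Rightarrow> real measure" and v :: "'i \<Rightarrow> real"
  assumes "finite I" and N: "\<And>i. real_distribution (N i)"
  shows "\<exists>\<mu>. real_distribution \<mu> \<and> (\<forall>t. char \<mu> t = (\<Prod>i\<in>I. char (N i) (v i * t)))"
proof -
  interpret N: real_distribution "N i" for i by (rule N)
  interpret P: product_prob_space N ..
  interpret PI: prob_space "PiM I N" by (intro prob_space_PiM N.prob_space_axioms)
  let ?X = "\<lambda>\<omega>. \<Sum>i\<in>I. v i * \<omega> i"
  have X [measurable]: "?X \<in> borel_measurable (PiM I N)" by measurable
  have "char (distr (PiM I N) borel ?X) t = (\<Prod>i\<in>I. char (N i) (v i * t))" for t
  proof -
    have "char (distr (PiM I N) borel ?X) t = (\<integral>\<omega>. iexp (t * ?X \<omega>) \<partial>PiM I N)"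
      unfolding char_def by (rule integral_distr) auto
    also have "\<dots> = (\<integral>\<omega>. (\<Prod>i\<in>I. iexp (v i * t * \<omega> i)) \<partial>PiM I N)"
      using \<open>finite I\<close> by (simp add: exp_sum[symmetric] sum_distrib_left mult_ac)
    also have "\<dots> = (\<Prod>i\<in>I. \<integral>x. iexp (v i * t * x) \<partial>N i)"
      by (rule P.product_integral_prod[OF \<open>finite I\<close>]) (auto intro!: N.integrable_iexp)
    finally show ?thesis by (simp add: char_def)
  qed
  then show ?thesis by (intro exI[of _ "distr (PiM I N) borel ?X"]) simp
qed

text \<open>
  The standard normal law is its own Fourier transform up to normalization, so averaging a
  characteristic function against it gives the integral of a bump function.
\<close>
lemma (in real_distribution) normal_average_of_char:
  "(\<integral>t. char M (t / R) \<partial>std_normal_distribution) = of_real (\<integral>x. exp (- ((x / R)^2) / 2) \<partial>M)"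
proof -
  interpret G: real_distribution std_normal_distribution by (rule real_dist_normal_dist)
  interpret P: pair_prob_space std_normal_distribution M ..
  have "(\<integral>t. char M (t / R) \<partial>std_normal_distribution) = (\<integral>t. \<integral>x. iexp (t / R * x) \<partial>M \<partial>std_normal_distribution)"
    by (simp add: char_def)
  also have "\<dots> = (\<integral>x. \<integral>t. iexp (t / R * x) \<partial>std_normal_distribution \<partial>M)"
    by (rule P.Fubini_integral[symmetric], rule P.P.integrable_const_bound[where B = 1]) (auto simp del: of_real_mult)
  also have "\<dots> = (\<integral>x. char std_normal_distribution (x / R) \<partial>M)"
    by (simp add: char_def mult.commute)
  finally show ?thesis
    by (simp add: char_std_normal_distribution)
qed

text \<open>
  Outside \<open>(- R, R]\<close> the deficit \<open>1 - exp (- (x / R)\<^sup>2 / 2)\<close> is at least \<open>1 - exp (- 1 / 2) \<ge> 1 / 3\<close>. The tail is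
  thus controlled by values of the characteristic function on the scale \<open>1 / R\<close>.
\<close>
lemma (in real_distribution) tail_le_normal_average:
  assumes "R > 0"
  shows "measure M {-R<..R} \<ge> 1 - 3 * (1 - Re (\<integral>t. char M (t / R) \<partial>std_normal_distribution))"
proof -
  let ?e = "\<lambda>x. exp (- ((x / R)^2) / 2)"
  have e1: "?e x \<le> 1" for x by simp
  have int: "integrable M ?e"
    by (rule integrable_const_bound[where B = 1]) auto
  have "indicator (- {-R<..R}) x \<le> 3 * (1 - ?e x)" for x
  proof (cases "x \<in> {-R<..R}")
    case False
    then have "\<bar>x\<bar> \<ge> R" by auto
    then have "(x / R)^2 \<ge> 1"
      using assms by (simp add: power_divide abs_le_square_iff[symmetric] abs_of_pos)
    then have "?e x \<le> exp (- (1/2))" by simp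
    also have "\<dots> \<le> 2/3"
      using exp_ge_add_one_self[of "1/2 :: real"] by (simp add: exp_minus field_simps)
    finally show ?thesis using False by simp
  qed (use e1[of x] in auto)
  then have "(\<integral>x. indicator (- {-R<..R}) x \<partial>M) \<le> (\<integral>x. 3 * (1 - ?e x) \<partial>M)"
    using int by (intro integral_mono) (auto simp: emeasure_eq_measure)
  also have "(\<integral>x. 3 * (1 - ?e x) \<partial>M) = 3 * (1 - (\<integral>x. ?e x \<partial>M))"
    using int prob_space by simp
  finally have "measure M (- {-R<..R}) \<le> 3 * (1 - (\<integral>x. ?e x \<partial>M))" by simp
  moreover have "measure M (- {-R<..R}) = 1 - measure M {-R<..R}"
    using prob_compl[of "{-R<..R}"] by (simp add: Compl_eq_Diff_UNIV)
  ultimately show ?thesis by (simp add: normal_average_of_char)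
qed

lemma (in real_distribution) tendsto_measure_symmetric_Ioc:
  "((\<lambda>k. measure M {- real k<..real k}) \<longlonglongrightarrow> 1)"
proof -
  have "(\<lambda>k. measure M {- real k<..real k}) \<longlonglongrightarrow> measure M (\<Union>k. {- real k<..real k})"
    by (rule finite_Lim_measure_incseq) (auto simp: incseq_def)
  then show ?thesis using prob_space by (simp add: UN_Ioc_eq_UNIV)
qed

text \<open>
  The existence half of Levy's continuity theorem. Continuity of the limit at \<open>0\<close> makes the normal
  average of \<open>\<psi>\<close> on the scale \<open>1 / R\<close> close to \<open>1\<close> for some \<open>R\<close>; for that \<open>R\<close>, all but finitely many of
  the laws have small tails, and the remaining ones are tight individually. A weakly convergent
  subsequence then has a limit with characteristic function \<open>\<psi>\<close>.
\<close>
theorem pointwise_limit_of_chars: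
  fixes M :: "nat \<Rightarrow> real measure" and \<psi> :: "real \<Rightarrow> complex"
  assumes M: "\<And>n. real_distribution (M n)"
    and lim: "\<And>t. (\<lambda>n. char (M n) t) \<longlonglongrightarrow> \<psi> t"
    and cont: "isCont \<psi> 0"
  shows "\<exists>\<mu>. real_distribution \<mu> \<and> char \<mu> = \<psi>"
proof -
  interpret M: real_distribution "M n" for n by (rule M)
  interpret G: real_distribution std_normal_distribution by (rule real_dist_normal_dist)
  have \<psi>0: "\<psi> 0 = 1"
    using LIMSEQ_unique[OF lim[of 0]] M.char_zero by simp
  have \<psi>1: "norm (\<psi> t) \<le> 1" for t
    by (rule Lim_bounded[OF tendsto_norm[OF lim]]) (auto intro: M.cmod_char_le_1)
  have \<psi>m [measurable]: "\<psi> \<in> borel_measurable borel"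
    by (rule borel_measurable_LIMSEQ_metric[OF M.char_measurable lim])
  define q where "q = (\<lambda>n R. 1 - Re (\<integral>t. char (M n) (t / R) \<partial>std_normal_distribution))"
  define Q where "Q = (\<lambda>R. 1 - Re (\<integral>t. \<psi> (t / R) \<partial>std_normal_distribution))"
  have q: "(\<lambda>n. q n R) \<longlonglongrightarrow> Q R" for R
    unfolding q_def Q_def
    by (intro tendsto_intros integral_dominated_convergence[where w = "\<lambda>_. 1"])
       (auto intro!: lim M.cmod_char_le_1)
  have "(\<lambda>k. Q (real (Suc k))) \<longlonglongrightarrow> 1 - Re (\<integral>t. 1 \<partial>std_normal_distribution)"
    unfolding Q_def
  proof (intro tendsto_intros integral_dominated_convergence[where w = "\<lambda>_. 1"])
    have "(\<lambda>k. \<psi> (t / real (Suc k))) \<longlonglongrightarrow> \<psi> 0" for t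
      by (rule isCont_tendsto_compose[OF cont]) real_asymp
    then show "AE t in std_normal_distribution. (\<lambda>k. \<psi> (t / real (Suc k))) \<longlonglongrightarrow> 1" by (simp add: \<psi>0)
  qed (auto intro!: \<psi>1)
  then have Q: "(\<lambda>k. Q (real (Suc k))) \<longlonglongrightarrow> 0"
    using G.prob_space by simp
  have "tight M"
    unfolding tight_def
  proof (intro conjI allI impI M)
    fix \<epsilon> :: real assume \<epsilon>: "\<epsilon> > 0"
    \<comment> \<open>one third of \<open>\<epsilon>\<close> compensates the factor \<open>3\<close> of \<open>tail_le_normal_average\<close>\<close>
    obtain k where k: "Q (real (Suc k)) < \<epsilon> / 3"
      using order_tendstoD(2)[OF Q, of "\<epsilon>/3"] \<epsilon> by (auto simp: eventually_sequentially)
    obtain N where N: "\<And>n. n \<ge> N \<Longrightarrow> q n (real (Suc k)) < \<epsilon> / 3"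
      using order_tendstoD(2)[OF q k] by (auto simp: eventually_sequentially)
    have "\<forall>\<^sub>F j in sequentially. \<forall>n\<in>{..<N}. measure (M n) {- real j<..real j} > 1 - \<epsilon>"
      using order_tendstoD(1)[OF M.tendsto_measure_symmetric_Ioc] \<epsilon>
      by (intro eventually_ball_finite) auto
    moreover have "\<forall>\<^sub>F j in sequentially. j \<ge> Suc k" by (rule eventually_ge_at_top)
    ultimately have "\<forall>\<^sub>F j in sequentially. j \<ge> Suc k \<and> (\<forall>n\<in>{..<N}. measure (M n) {- real j<..real j} > 1 - \<epsilon>)"
      by eventually_elim simp
    then obtain j where j: "j \<ge> Suc k" "\<And>n. n < N \<Longrightarrow> measure (M n) {- real j<..real j} > 1 - \<epsilon>"
      by (auto simp: eventually_sequentially)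
    have "measure (M n) {- real j<..real j} > 1 - \<epsilon>" for n
    proof (cases "n < N")
      case False
      have "1 - \<epsilon> < 1 - 3 * q n (real (Suc k))" using N[of n] False by simp
      also have "\<dots> \<le> measure (M n) {- real (Suc k)<..real (Suc k)}"
        unfolding q_def by (rule M.tail_le_normal_average) simp
      also have "\<dots> \<le> measure (M n) {- real j<..real j}"
        using j(1) by (intro M.finite_measure_mono) auto
      finally show ?thesis .
    qed (use j in auto)
    then show "\<exists>a b. a < b \<and> (\<forall>n. 1 - \<epsilon> < measure (M n) {a<..b})"
      using j(1) by (intro exI[of _ "- real j"] exI[of _ "real j"]) auto
  qed
  from tight_imp_convergent_subsubsequence[OF this strict_mono_id] obtain r \<mu>
    where r: "strict_mono (r :: nat \<Rightarrow> nat)" and \<mu>: "real_distribution \<mu>" and w: "weak_conv_m (M \<circ> id \<circ> r) \<mu>"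
    by auto
  have "char \<mu> t = \<psi> t" for t
  proof (rule LIMSEQ_unique)
    show "(\<lambda>n. char ((M \<circ> id \<circ> r) n) t) \<longlonglongrightarrow> char \<mu> t"
      by (rule levy_continuity1[OF _ \<mu> w]) (simp add: M)
    show "(\<lambda>n. char ((M \<circ> id \<circ> r) n) t) \<longlonglongrightarrow> \<psi> t"
      using LIMSEQ_subseq_LIMSEQ[OF lim[of t] r] by (simp add: comp_def)
  qed
  with \<mu> show ?thesis by auto
qed

section \<open>The exponent of a log-integrable measure\<close>

text \<open>
  The level sets are numbered by natural numbers because the independence property of the process is
  stated for such partitions. The integral formula is provided for every measure at once, since it is
  applied both to the realisations of the process and to its parameter.
\<close>
lemma simple_function_level_sets:
  fixes f :: "real \<Rightarrow> complex"
  assumes f: "simple_function borel f"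
  obtains k :: nat and h B where
    "\<And>j. j < k \<Longrightarrow> B j \<in> sets borel" "disjoint_family_on B {..<k}" "(\<Union>j<k. B j) = UNIV"
    "\<And>j. j < k \<Longrightarrow> h j \<in> range f"
    "\<And>N g. finite_measure N \<Longrightarrow> sets N = sets borel \<Longrightarrow>
       integrable N (\<lambda>x. g (f x) :: complex)
       \<and> (\<integral>x. g (f x) \<partial>N) = (\<Sum>j<k. of_real (measure N (B j)) * g (h j))"
proof -
  have fin: "finite (range f)" using f by (simp add: simple_function_def)
  define k where "k = card (range f)"
  obtain h where h: "bij_betw h {..<k} (range f)"
    using ex_bij_betw_nat_finite[OF fin] by (auto simp: k_def lessThan_atLeast0)
  define B where "B = (\<lambda>j. f -` {h j})"
  have B: "B j \<in> sets borel" if "j < k" for j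
    using simple_functionD(2)[OF f, of "{h j}"] by (simp add: B_def)
  have inj: "inj_on h {..<k}" and im: "h ` {..<k} = range f" using h by (auto simp: bij_betw_def)
  have disj: "disjoint_family_on B {..<k}"
    using inj by (auto simp: disjoint_family_on_def B_def inj_on_def)
  have un: "(\<Union>j<k. B j) = UNIV"
  proof -
    have "\<exists>j\<in>{..<k}. f x = h j" for x using im by (metis imageE rangeI)
    then show ?thesis by (auto simp: B_def)
  qed
  have h_in: "h j \<in> range f" if "j < k" for j using im that by auto
  have eq: "g (f x) = (\<Sum>j<k. indicator (B j) x *\<^sub>R g (h j))" for g :: "complex \<Rightarrow> complex" and x
  proof -
    obtain i where i: "i < k" "f x = h i" using im by (metis imageE lessThan_iff rangeI)
    have "(\<Sum>j<k. indicator (B j) x *\<^sub>R g (h j)) = (\<Sum>j<k. if j = i then g (h i) else 0)"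
      using i inj by (intro sum.cong) (auto simp: B_def inj_on_def split: split_indicator)
    then show ?thesis using i by simp
  qed
  have int: "integrable N (\<lambda>x. g (f x)) \<and> (\<integral>x. g (f x) \<partial>N) = (\<Sum>j<k. of_real (measure N (B j)) * g (h j))"
    if "finite_measure N" "sets N = sets borel" for N and g :: "complex \<Rightarrow> complex"
  proof -
    interpret finite_measure N by fact
    have [simp]: "integrable N (\<lambda>x. indicator (B j) x *\<^sub>R g (h j))" if "j < k" for j
      using B[OF that] \<open>sets N = sets borel\<close> by (auto simp: emeasure_eq_measure)
    have UN: "space N = UNIV" using sets_eq_imp_space_eq[OF \<open>sets N = sets borel\<close>] by simp
    show ?thesis unfolding eq
      using B \<open>sets N = sets borel\<close> UN
      by (auto simp: Bochner_Integration.integral_sum scaleR_conv_of_real emeasure_eq_measure)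
  qed
  show ?thesis by (rule that[OF B disj un h_in int])
qed

text \<open>
  General simple approximations may leave the right half-plane, where the exponentials would not be
  bounded; truncating the real part at \<open>0\<close> repairs this without increasing the modulus.
\<close>
lemma simple_approximation_right_half_plane:
  fixes f :: "real \<Rightarrow> complex"
  assumes f: "f \<in> borel_measurable borel" and pos: "\<And>x. Re (f x) \<ge> 0"
  obtains s where "\<And>i. simple_function borel (s i)" "\<And>i x. Re (s i x) \<ge> 0"
    "\<And>x. (\<lambda>i. s i x) \<longlonglongrightarrow> f x" "\<And>i x. norm (s i x :: complex) \<le> 2 * norm (f x)"
proof -
  obtain F where F: "\<And>i. simple_function borel (F i)" "\<And>x. (\<lambda>i. F i x) \<longlonglongrightarrow> f x"
    "\<And>i x. norm (F i x) \<le> 2 * norm (f x)"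
    using borel_measurable_implies_sequence_metric[OF f, of 0] by (auto simp: dist_norm)
  \<comment> \<open>the nearest-point projection onto the closed right half-plane\<close>
  define p where "p = (\<lambda>z. Complex (max 0 (Re z)) (Im z))"
  have p_le: "norm (p z) \<le> norm z" for z
    unfolding p_def cmod_def by (auto intro!: real_sqrt_le_mono add_right_mono power_mono simp: max_def)
  have p_lim: "(\<lambda>i. p (F i x)) \<longlonglongrightarrow> f x" for x
  proof -
    have "(\<lambda>i. p (F i x)) \<longlonglongrightarrow> p (f x)"
      unfolding p_def by (intro tendsto_intros F)
    also have "p (f x) = f x" using pos[of x] by (simp add: p_def complex_eq_iff)
    finally show ?thesis .
  qed
  show ?thesis
  proof (rule that[of "\<lambda>i x. p (F i x)"])
    show "simple_function borel (\<lambda>x. p (F i x))" for i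
      using simple_function_compose[OF F(1)[of i], of p] by (simp add: comp_def)
    show "norm (p (F i x)) \<le> 2 * norm (f x)" for i x
      using p_le[of "F i x"] F(3)[of i x] by linarith
  qed (use p_lim in \<open>auto simp: p_def\<close>)
qed

lemma ln_one_plus_mult_le:
  fixes c r :: real
  assumes "c \<ge> 0" "r \<ge> 0"
  shows "ln (1 + c * r) \<le> ln (1 + c) + ln (1 + r)"
proof -
  have "ln (1 + c * r) \<le> ln ((1 + c) * (1 + r))"
    using assms by (subst ln_le_cancel_iff) (auto simp: algebra_simps add_pos_nonneg)
  also have "\<dots> = ln (1 + c) + ln (1 + r)" using assms by (intro ln_mult_pos) auto
  finally show ?thesis .
qed

lemma (in finite_measure) integrable_ln_scale:
  fixes b :: "'a \<Rightarrow> real"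
  assumes [measurable]: "b \<in> borel_measurable M" and b: "\<And>x. b x \<ge> 0"
    and int: "integrable M (\<lambda>x. ln (1 + b x))" and c: "c \<ge> 0"
  shows "integrable M (\<lambda>x. ln (1 + c * b x))"
proof (rule Bochner_Integration.integrable_bound)
  show "integrable M (\<lambda>x. ln (1 + c) + ln (1 + b x))" using int by auto
  show "AE x in M. norm (ln (1 + c * b x)) \<le> norm (ln (1 + c) + ln (1 + b x))"
    using ln_one_plus_mult_le[OF c b] b c by (intro AE_I2) auto
qed measurable

lemma one_plus_not_nonpos: "Re z \<ge> 0 \<Longrightarrow> 1 + z \<notin> \<real>\<^sub>\<le>\<^sub>0"
  by (rule half_plane) (rule half_plane)

lemma (in finite_measure) integral_Ln_tendsto:
  fixes f :: "nat \<Rightarrow> 'a \<Rightarrow> complex"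
  assumes [measurable]: "\<And>k. f k \<in> borel_measurable M" "F \<in> borel_measurable M" "b \<in> borel_measurable M"
    and pos: "\<And>k x. Re (f k x) \<ge> 0"
    and lim: "\<And>x. (\<lambda>k. f k x) \<longlonglongrightarrow> F x"
    and le: "\<And>k x. norm (f k x) \<le> b x"
    and int: "integrable M (\<lambda>x. ln (1 + b x))"
  shows "(\<lambda>k. \<integral>x. Ln (1 + f k x) \<partial>M) \<longlonglongrightarrow> (\<integral>x. Ln (1 + F x) \<partial>M)"
proof (rule integral_dominated_convergence[where w = "\<lambda>x. 4 * ln (1 + b x)"])
  have posF: "Re (F x) \<ge> 0" for x
    by (rule LIMSEQ_le_const[OF tendsto_Re[OF lim[of x]]]) (auto intro: pos)
  show "AE x in M. (\<lambda>k. Ln (1 + f k x)) \<longlonglongrightarrow> Ln (1 + F x)"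
    by (intro AE_I2 tendsto_intros lim one_plus_not_nonpos posF)
  show "AE x in M. norm (Ln (1 + f k x)) \<le> 4 * ln (1 + b x)" for k
  proof (rule AE_I2)
    fix x
    have "norm (Ln (1 + f k x)) \<le> 4 * ln (1 + norm (f k x))" by (rule norm_Ln_le[OF pos])
    also have "\<dots> \<le> 4 * ln (1 + b x)" using le[of k x] by (auto simp: add_pos_nonneg intro!: ln_mono)
    finally show "norm (Ln (1 + f k x)) \<le> 4 * ln (1 + b x)" .
  qed
  show "(\<lambda>x. Ln (1 + F x)) \<in> borel_measurable M" "(\<lambda>x. Ln (1 + f k x)) \<in> borel_measurable M" for k
    by measurable
qed (use int in auto)

text \<open>
  The measures for which the integral of the identity against the gamma process converges.
\<close>
locale log_finite_measure = finite_measure \<alpha> for \<alpha> :: "real measure" +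
  assumes sets_eq_borel [simp, measurable_cong]: "sets \<alpha> = sets borel"
    and integrable_log: "integrable \<alpha> (\<lambda>x. ln (1 + \<bar>x\<bar>))"
begin

lemma space_eq_UNIV [simp]: "space \<alpha> = UNIV"
  using sets_eq_imp_space_eq[OF sets_eq_borel] by simp

lemma integrable_log_scale: "c \<ge> 0 \<Longrightarrow> integrable \<alpha> (\<lambda>x. ln (1 + c * \<bar>x\<bar>))"
  by (rule integrable_ln_scale[OF _ _ integrable_log]) auto

text \<open>
  Minus the logarithm of the characteristic function of the integral of the identity against the
  gamma process with parameter \<open>\<alpha>\<close>; the principal branch is the right one since \<open>Re (1 - i t x) = 1\<close>.
\<close>
definition log_exponent :: "real \<Rightarrow> complex" where
  "log_exponent t = (\<integral>x. Ln (1 - \<i> * of_real (t * x)) \<partial>\<alpha>)"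

lemma isCont_log_exponent: "isCont log_exponent t"
  unfolding continuous_at_sequentially comp_def
proof (intro allI impI)
  fix u :: "nat \<Rightarrow> real" assume u: "u \<longlonglongrightarrow> t"
  obtain K where K: "K > 0" "\<And>n. norm (u n) \<le> K"
    using u by (meson BseqE convergentI convergent_imp_Bseq)
  have "(\<lambda>k. \<integral>x. Ln (1 + - (\<i> * of_real (u k * x))) \<partial>\<alpha>) \<longlonglongrightarrow> (\<integral>x. Ln (1 + - (\<i> * of_real (t * x))) \<partial>\<alpha>)"
    by (rule integral_Ln_tendsto[where b = "\<lambda>x. K * \<bar>x\<bar>"])
       (use K in \<open>auto intro!: tendsto_intros u integrable_log_scale mult_right_mono simp: norm_mult abs_mult\<close>)
  then show "(\<lambda>n. log_exponent (u n)) \<longlonglongrightarrow> log_exponent t"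
    by (simp add: log_exponent_def)
qed

text \<open>
  For \<open>c = 1 / n\<close> this is the \<open>n\<close>-th convolution root required by infinite divisibility. If the identity
  is replaced by a simple function with values \<open>h\<^sub>j\<close> on sets \<open>B\<^sub>j\<close>, the function is the characteristic
  function of \<open>\<Sum> h\<^sub>j X\<^sub>j\<close> for independent gamma variables \<open>X\<^sub>j\<close> of shape \<open>c \<alpha>(B\<^sub>j)\<close>.
\<close>
theorem exists_char_exp_log_exponent:
  assumes c: "c \<ge> 0"
  shows "\<exists>\<mu>. real_distribution \<mu> \<and> char \<mu> = (\<lambda>t. exp (- of_real c * log_exponent t))"
proof -
  obtain s where s: "\<And>i. simple_function borel (s i)" "\<And>x. (\<lambda>i. s i x) \<longlonglongrightarrow> (\<i> * of_real x)"
     "\<And>i x. norm (s i x) \<le> 2 * norm (\<i> * of_real x)"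
    by (rule simple_approximation_right_half_plane[of "\<lambda>x. \<i> * of_real x"]) auto
  define r where "r = (\<lambda>i x. Im (s i x))"
  have r: "simple_function borel (\<lambda>x. of_real (r i x) :: complex)" "\<And>x. (\<lambda>i. r i x) \<longlonglongrightarrow> x"
     "\<bar>r i x\<bar> \<le> 2 * \<bar>x\<bar>" for i x
  proof -
    show "simple_function borel (\<lambda>x. of_real (r i x) :: complex)"
      using simple_function_compose[OF s(1)[of i], of "\<lambda>z. of_real (Im z)"] by (simp add: comp_def r_def)
    show "(\<lambda>i. r i x) \<longlonglongrightarrow> x" for x using tendsto_Im[OF s(2)[of x]] by (simp add: r_def)
    show "\<bar>r i x\<bar> \<le> 2 * \<bar>x\<bar>"
      using s(3)[of i x] abs_Im_le_cmod[of "s i x"] by (simp add: r_def norm_mult)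
  qed
  have rm [measurable]: "r i \<in> borel_measurable borel" for i
    using borel_measurable_simple_function[OF s(1)[of i]] unfolding r_def by measurable
  have "\<exists>\<mu>. real_distribution \<mu> \<and> (\<forall>t. char \<mu> t = exp (- of_real c * (\<integral>x. Ln (1 - \<i> * of_real (t * r i x)) \<partial>\<alpha>)))" for i
  proof -
    obtain k :: nat and h B where
      B: "\<And>j. j < k \<Longrightarrow> h j \<in> range (\<lambda>x. of_real (r i x) :: complex)"
      and eq: "\<And>g. (\<integral>x. g (of_real (r i x) :: complex) \<partial>\<alpha>) = (\<Sum>j<k. of_real (measure \<alpha> (B j)) * (g (h j) :: complex))"
      using simple_function_level_sets[OF r(1)[of i]] finite_measure_axioms sets_eq_borel by metis
    obtain \<mu> where \<mu>: "real_distribution \<mu>"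
      "\<And>t. char \<mu> t = (\<Prod>j<k. char (gamma_law (c * measure \<alpha> (B j))) (Re (h j) * t))"
      using exists_real_distribution_prod_char[of "{..<k}" "\<lambda>j. gamma_law (c * measure \<alpha> (B j))" "\<lambda>j. Re (h j)"]
        real_distribution_gamma_law c by (auto simp: measure_nonneg)
    have "char \<mu> t = exp (- of_real c * (\<integral>x. Ln (1 - \<i> * of_real (t * r i x)) \<partial>\<alpha>))" for t
    proof -
      have "char (gamma_law (c * measure \<alpha> (B j))) (Re (h j) * t)
          = exp (- of_real c * (of_real (measure \<alpha> (B j)) * Ln (1 - \<i> * of_real t * h j)))" if "j < k" for j
      proof -
        have h: "of_real (Re (h j)) = h j" using B[OF that] by auto
        have "char (gamma_law (c * measure \<alpha> (B j))) (Re (h j) * t)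
           = (\<integral>x. exp (- (- (\<i> * of_real (Re (h j) * t))) * of_real x) \<partial>gamma_law (c * measure \<alpha> (B j)))"
          by (simp add: char_def mult_ac)
        also have "\<dots> = exp (- of_real (c * measure \<alpha> (B j)) * Ln (1 + - (\<i> * of_real (Re (h j) * t))))"
          using c by (intro gamma_law_exponential_transform half_plane) (auto simp: measure_nonneg)
        finally show ?thesis by (simp add: h mult_ac)
      qed
      then have "char \<mu> t = (\<Prod>j<k. exp (- of_real c * (of_real (measure \<alpha> (B j)) * Ln (1 - \<i> * of_real t * h j))))"
        by (simp add: \<mu>(2))
      also have "\<dots> = exp (- of_real c * (\<Sum>j<k. of_real (measure \<alpha> (B j)) * Ln (1 - \<i> * of_real t * h j)))"
        by (simp add: exp_sum[symmetric] sum_distrib_left sum_negf)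
      also have "(\<Sum>j<k. of_real (measure \<alpha> (B j)) * Ln (1 - \<i> * of_real t * h j))
          = (\<integral>x. Ln (1 - \<i> * of_real t * of_real (r i x)) \<partial>\<alpha>)"
        using eq[of "\<lambda>z. Ln (1 - \<i> * of_real t * z)"] by simp
      finally show ?thesis by (simp add: mult.assoc)
    qed
    with \<mu>(1) show ?thesis by auto
  qed
  then obtain \<mu> where \<mu>: "\<And>i. real_distribution (\<mu> i)"
    "\<And>i t. char (\<mu> i) t = exp (- of_real c * (\<integral>x. Ln (1 - \<i> * of_real (t * r i x)) \<partial>\<alpha>))"
    by metis
  show ?thesis
  proof (rule pointwise_limit_of_chars[OF \<mu>(1)])
    fix t
    have "(\<lambda>k. \<integral>x. Ln (1 + - (\<i> * of_real (t * r k x))) \<partial>\<alpha>) \<longlonglongrightarrow> (\<integral>x. Ln (1 + - (\<i> * of_real (t * x))) \<partial>\<alpha>)"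
    proof (rule integral_Ln_tendsto[where b = "\<lambda>x. (\<bar>t\<bar> * 2) * \<bar>x\<bar>"])
      show "norm (- (\<i> * of_real (t * r k x))) \<le> (\<bar>t\<bar> * 2) * \<bar>x\<bar>" for k x
        using mult_left_mono[OF r(3)[of k x], of "\<bar>t\<bar>"] by (simp add: norm_mult abs_mult)
    qed (auto intro!: tendsto_intros r integrable_log_scale)
    then show "(\<lambda>n. char (\<mu> n) t) \<longlonglongrightarrow> exp (- of_real c * log_exponent t)"
      unfolding \<mu>(2) log_exponent_def by (intro tendsto_intros) simp
  qed (intro continuous_intros isCont_log_exponent)
qed

end

section \<open>Exponential functionals of the gamma process\<close>

locale log_gamma_process = gamma_process M \<alpha> \<xi> + \<alpha>: log_finite_measure \<alpha>
  for M :: "'w measure" and \<alpha> :: "real measure" and \<xi> :: "'w \<Rightarrow> real measure"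
begin

lemma measurable_process_iff:
  "\<omega> \<in> space M \<Longrightarrow> f \<in> borel_measurable (\<xi> \<omega>) \<longleftrightarrow> f \<in> borel_measurable borel"
  using measurable_cong_sets[OF sets_process refl] by blast

lemma simple_integral_process:
  assumes f: "simple_function borel f" and pos: "\<And>x. Re (f x) \<ge> 0"
  shows "(\<lambda>\<omega>. \<integral>x. f x \<partial>\<xi> \<omega>) \<in> borel_measurable M"
    and "(\<integral>\<omega>. exp (- (\<integral>x. f x \<partial>\<xi> \<omega>)) \<partial>M) = exp (- (\<integral>x. Ln (1 + f x) \<partial>\<alpha>))"
proof -
  obtain k :: nat and h B where B: "\<And>j. j < k \<Longrightarrow> B j \<in> sets borel" "disjoint_family_on B {..<k}"
      "(\<Union>j<k. B j) = UNIV" "\<And>j. j < k \<Longrightarrow> h j \<in> range f"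
    and eq: "\<And>N g. finite_measure N \<Longrightarrow> sets N = sets borel \<Longrightarrow>
       integrable N (\<lambda>x. g (f x) :: complex)
       \<and> (\<integral>x. g (f x) \<partial>N) = (\<Sum>j<k. of_real (measure N (B j)) * g (h j))"
    by (rule simple_function_level_sets[OF f]) (rule that)
  have \<xi>_eq: "(\<integral>x. f x \<partial>\<xi> \<omega>) = (\<Sum>j<k. of_real (measure (\<xi> \<omega>) (B j)) * h j)" if "\<omega> \<in> space M" for \<omega>
    using eq[OF finite_process sets_process, OF that that, of "\<lambda>z. z"] by simp
  have [measurable]: "(\<lambda>\<omega>. measure (\<xi> \<omega>) (B j)) \<in> borel_measurable M" if "j < k" for j
    using measurable_process B(1) that by blast
  show "(\<lambda>\<omega>. \<integral>x. f x \<partial>\<xi> \<omega>) \<in> borel_measurable M"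
    by (subst measurable_cong[OF \<xi>_eq]) auto
  have pos_h: "Re (h j) \<ge> 0" if "j < k" for j using B(4)[OF that] pos by auto
  have "(\<integral>\<omega>. exp (- (\<integral>x. f x \<partial>\<xi> \<omega>)) \<partial>M) = (\<integral>\<omega>. (\<Prod>j<k. exp (- h j * of_real (measure (\<xi> \<omega>) (B j)))) \<partial>M)"
    by (intro Bochner_Integration.integral_cong refl) (simp add: \<xi>_eq exp_sum[symmetric] sum_negf mult.commute)
  also have "\<dots> = (\<Prod>j<k. \<integral>\<omega>. exp (- h j * of_real (measure (\<xi> \<omega>) (B j))) \<partial>M)"
  proof (rule indep_vars_lebesgue_integral)
    show "indep_vars (\<lambda>_. borel) (\<lambda>j \<omega>. exp (- h j * of_real (measure (\<xi> \<omega>) (B j)))) {..<k}"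
      by (rule indep_vars_compose2[OF indep_process[OF B(1-3)], where Y = "\<lambda>j x. exp (- h j * of_real x)"]) auto
    show "integrable M (\<lambda>\<omega>. exp (- h j * of_real (measure (\<xi> \<omega>) (B j))))" if "j \<in> {..<k}" for j
      using that pos_h by (intro integrable_const_bound[where B = 1]) (auto simp: mult_nonneg_nonneg)
  qed simp
  also have "\<dots> = (\<Prod>j<k. exp (- (of_real (measure \<alpha> (B j)) * Ln (1 + h j))))"
  proof (intro prod.cong refl)
    fix j assume "j \<in> {..<k}"
    then have j: "j < k" by simp
    have "(\<integral>\<omega>. exp (- h j * of_real (measure (\<xi> \<omega>) (B j))) \<partial>M)
        = (\<integral>x. exp (- h j * of_real x) \<partial>distr M borel (\<lambda>\<omega>. measure (\<xi> \<omega>) (B j)))"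
      using j by (intro integral_distr[symmetric]) auto
    also have "\<dots> = exp (- of_real (measure \<alpha> (B j)) * Ln (1 + h j))"
      unfolding distr_process[OF B(1)[OF j]]
      by (intro gamma_law_exponential_transform half_plane pos_h j measure_nonneg)
    finally show "(\<integral>\<omega>. exp (- h j * of_real (measure (\<xi> \<omega>) (B j))) \<partial>M)
        = exp (- (of_real (measure \<alpha> (B j)) * Ln (1 + h j)))" by simp
  qed
  also have "\<dots> = exp (- (\<integral>x. Ln (1 + f x) \<partial>\<alpha>))"
    using eq[OF \<alpha>.finite_measure_axioms \<alpha>.sets_eq_borel, of "\<lambda>z. Ln (1 + z)"]
    by (simp add: exp_sum[symmetric] sum_negf)
  finally show "(\<integral>\<omega>. exp (- (\<integral>x. f x \<partial>\<xi> \<omega>)) \<partial>M) = exp (- (\<integral>x. Ln (1 + f x) \<partial>\<alpha>))" .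
qed

text \<open>
  The process is only assumed to be measurable on Borel sets; measurability of integrals against it
  is inherited through the standard construction of nonnegative functions from indicators.
\<close>
lemma nn_integral_process_measurable:
  assumes "u \<in> borel_measurable borel"
  shows "(\<lambda>\<omega>. \<integral>\<^sup>+x. u x \<partial>\<xi> \<omega>) \<in> borel_measurable M"
  using assms
proof (induction rule: borel_measurable_induct)
  case (cong f g)
  then have "f = g" by (simp add: fun_eq_iff)
  then show ?case using cong by simp
next
  case (set A)
  have "(\<integral>\<^sup>+x. indicator A x \<partial>\<xi> \<omega>) = ennreal (measure (\<xi> \<omega>) A)" if "\<omega> \<in> space M" for \<omega>
    using set that sets_process[OF that]
    by (simp add: finite_measure.emeasure_eq_measure[OF finite_process[OF that]])
  then show ?case using measurable_process[OF set] by (subst measurable_cong) auto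
next
  case (mult u c)
  have "(\<integral>\<^sup>+x. c * u x \<partial>\<xi> \<omega>) = c * (\<integral>\<^sup>+x. u x \<partial>\<xi> \<omega>)" if "\<omega> \<in> space M" for \<omega>
    using mult that by (intro nn_integral_cmult) (simp add: measurable_process_iff)
  then have "(\<lambda>\<omega>. \<integral>\<^sup>+x. c * u x \<partial>\<xi> \<omega>) \<in> borel_measurable M
      \<longleftrightarrow> (\<lambda>\<omega>. c * (\<integral>\<^sup>+x. u x \<partial>\<xi> \<omega>)) \<in> borel_measurable M"
    by (rule measurable_cong)
  then show ?case using mult by simp
next
  case (add u v)
  have "(\<integral>\<^sup>+x. v x + u x \<partial>\<xi> \<omega>) = (\<integral>\<^sup>+x. v x \<partial>\<xi> \<omega>) + (\<integral>\<^sup>+x. u x \<partial>\<xi> \<omega>)" if "\<omega> \<in> space M" for \<omega>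
    using add that by (intro nn_integral_add) (simp_all add: measurable_process_iff)
  then have "(\<lambda>\<omega>. \<integral>\<^sup>+x. v x + u x \<partial>\<xi> \<omega>) \<in> borel_measurable M
      \<longleftrightarrow> (\<lambda>\<omega>. (\<integral>\<^sup>+x. v x \<partial>\<xi> \<omega>) + (\<integral>\<^sup>+x. u x \<partial>\<xi> \<omega>)) \<in> borel_measurable M"
    by (rule measurable_cong)
  then show ?case using add by simp
next
  case (seq U)
  have "(\<integral>\<^sup>+x. (SUP i. U i) x \<partial>\<xi> \<omega>) = (SUP i. \<integral>\<^sup>+x. U i x \<partial>\<xi> \<omega>)" if "\<omega> \<in> space M" for \<omega>
    unfolding SUP_apply
    using seq that by (intro nn_integral_monotone_convergence_SUP) (simp_all add: measurable_process_iff)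
  then have "(\<lambda>\<omega>. \<integral>\<^sup>+x. (SUP i. U i) x \<partial>\<xi> \<omega>) \<in> borel_measurable M
      \<longleftrightarrow> (\<lambda>\<omega>. SUP i. \<integral>\<^sup>+x. U i x \<partial>\<xi> \<omega>) \<in> borel_measurable M"
    by (rule measurable_cong)
  then show ?case using seq by simp
qed

lemma integrable_process_measurable:
  fixes f :: "real \<Rightarrow> complex"
  assumes f: "f \<in> borel_measurable borel"
  shows "{\<omega> \<in> space M. integrable (\<xi> \<omega>) f} \<in> sets M"
proof -
  have "{\<omega> \<in> space M. integrable (\<xi> \<omega>) f} = {\<omega> \<in> space M. (\<integral>\<^sup>+x. ennreal (norm (f x)) \<partial>\<xi> \<omega>) < \<infinity>}"
    using f by (auto simp: integrable_iff_bounded measurable_process_iff)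
  also have "\<dots> \<in> sets M"
    using nn_integral_process_measurable[of "\<lambda>x. ennreal (norm (f x))"] f by measurable
  finally show ?thesis .
qed

text \<open>
  Measurability is part of the claim: where \<open>f\<close> is not \<open>\<xi> \<omega>\<close>-integrable, the integral is \<open>0\<close> by
  convention, so the exceptional set has to be shown measurable before the integral can be written as
  a limit of measurable functions.
\<close>
theorem exponential_functional:
  assumes f: "f \<in> borel_measurable borel" and pos: "\<And>x. Re (f x) \<ge> 0"
    and log: "integrable \<alpha> (\<lambda>x. ln (1 + norm (f x)))"
    and int: "AE \<omega> in M. integrable (\<xi> \<omega>) f"
  shows "(\<lambda>\<omega>. \<integral>x. f x \<partial>\<xi> \<omega>) \<in> borel_measurable M"
    and "(\<integral>\<omega>. exp (- (\<integral>x. f x \<partial>\<xi> \<omega>)) \<partial>M) = exp (- (\<integral>x. Ln (1 + f x) \<partial>\<alpha>))"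
proof -
  obtain s where s: "\<And>i. simple_function borel (s i)" "\<And>i x. Re (s i x) \<ge> 0"
    "\<And>x. (\<lambda>i. s i x) \<longlonglongrightarrow> f x" "\<And>i x. norm (s i x) \<le> 2 * norm (f x)"
    using simple_approximation_right_half_plane[OF f pos] by blast
  have sm [measurable]: "s i \<in> borel_measurable borel" for i
    by (rule borel_measurable_simple_function[OF s(1)])
  note [measurable] = f simple_integral_process(1)[OF s(1,2)]
  define I where "I = {\<omega> \<in> space M. integrable (\<xi> \<omega>) f}"
  have I [measurable]: "I \<in> sets M" unfolding I_def by (rule integrable_process_measurable[OF f])
  have lim: "(\<lambda>i. \<integral>x. s i x \<partial>\<xi> \<omega>) \<longlonglongrightarrow> (\<integral>x. f x \<partial>\<xi> \<omega>)" if "\<omega> \<in> I" for \<omega>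
    by (rule integral_dominated_convergence[where w = "\<lambda>x. 2 * norm (f x)"])
       (use that s in \<open>auto simp: I_def measurable_process_iff f sm\<close>)
  have zero: "(\<integral>x. f x \<partial>\<xi> \<omega>) = 0" if "\<omega> \<in> space M - I" for \<omega>
    using that by (auto simp: I_def not_integrable_integral_eq)
  have *: "(\<lambda>\<omega>. if \<omega> \<in> I then \<integral>x. s i x \<partial>\<xi> \<omega> else 0) \<in> borel_measurable M" for i by measurable
  show fm [measurable]: "(\<lambda>\<omega>. \<integral>x. f x \<partial>\<xi> \<omega>) \<in> borel_measurable M"
  proof (rule borel_measurable_LIMSEQ_metric[OF *])
    fix \<omega> assume "\<omega> \<in> space M"
    then show "(\<lambda>i. if \<omega> \<in> I then \<integral>x. s i x \<partial>\<xi> \<omega> else 0) \<longlonglongrightarrow> (\<integral>x. f x \<partial>\<xi> \<omega>)"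
      using lim zero by (cases "\<omega> \<in> I") auto
  qed
  have "(\<lambda>i. \<integral>\<omega>. exp (- (\<integral>x. s i x \<partial>\<xi> \<omega>)) \<partial>M) \<longlonglongrightarrow> (\<integral>\<omega>. exp (- (\<integral>x. f x \<partial>\<xi> \<omega>)) \<partial>M)"
  proof (rule integral_dominated_convergence[where w = "\<lambda>_. 1"])
    show "AE \<omega> in M. (\<lambda>i. exp (- (\<integral>x. s i x \<partial>\<xi> \<omega>))) \<longlonglongrightarrow> exp (- (\<integral>x. f x \<partial>\<xi> \<omega>))"
      using int AE_space by eventually_elim (auto intro!: tendsto_intros lim simp: I_def)
    show "AE \<omega> in M. norm (exp (- (\<integral>x. s i x \<partial>\<xi> \<omega>))) \<le> 1" for i
    proof (rule AE_I2)
      fix \<omega> assume \<omega>: "\<omega> \<in> space M"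
      have "integrable (\<xi> \<omega>) (s i)"
      proof (rule finite_measure.integrable_const_bound[OF finite_process[OF \<omega>]])
        show "AE x in \<xi> \<omega>. norm (s i x) \<le> Max (norm ` range (s i))"
          using s(1)[of i] by (intro AE_I2 Max_ge) (auto simp: simple_function_def)
      qed (simp add: measurable_process_iff \<omega> sm)
      then have "Re (\<integral>x. s i x \<partial>\<xi> \<omega>) = (\<integral>x. Re (s i x) \<partial>\<xi> \<omega>)" by simp
      also have "\<dots> \<ge> 0" by (intro integral_nonneg_AE AE_I2 s)
      finally show "norm (exp (- (\<integral>x. s i x \<partial>\<xi> \<omega>))) \<le> 1" by simp
    qed
  qed auto
  moreover have "(\<lambda>i. exp (- (\<integral>x. Ln (1 + s i x) \<partial>\<alpha>))) \<longlonglongrightarrow> exp (- (\<integral>x. Ln (1 + f x) \<partial>\<alpha>))"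
    by (intro tendsto_intros \<alpha>.integral_Ln_tendsto[where b = "\<lambda>x. 2 * norm (f x)"]
          \<alpha>.integrable_ln_scale log s) auto
  ultimately show "(\<integral>\<omega>. exp (- (\<integral>x. f x \<partial>\<xi> \<omega>)) \<partial>M) = exp (- (\<integral>x. Ln (1 + f x) \<partial>\<alpha>))"
    unfolding simple_integral_process(2)[OF s(1,2)] by (rule LIMSEQ_unique)
qed

lemma laplace_functional_bounded:
  fixes u :: "real \<Rightarrow> real"
  assumes [measurable]: "u \<in> borel_measurable borel" and u: "\<And>x. 0 \<le> u x" "\<And>x. u x \<le> b"
  shows "(\<lambda>\<omega>. \<integral>x. u x \<partial>\<xi> \<omega>) \<in> borel_measurable M"
    and "(\<integral>\<omega>. exp (- (\<integral>x. u x \<partial>\<xi> \<omega>)) \<partial>M) = exp (- (\<integral>x. ln (1 + u x) \<partial>\<alpha>))"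
proof -
  have int: "integrable (\<xi> \<omega>) (\<lambda>x. of_real (u x) :: complex)" if "\<omega> \<in> space M" for \<omega>
    by (rule finite_measure.integrable_const_bound[OF finite_process[OF that], where B = b])
       (use u that in \<open>auto simp: measurable_process_iff\<close>)
  have log: "integrable \<alpha> (\<lambda>x. ln (1 + norm (complex_of_real (u x))))"
    by (rule \<alpha>.integrable_const_bound[where B = "ln (1 + b)"])
       (use u order_trans[OF u] in \<open>auto simp: add_pos_nonneg intro!: AE_I2 ln_mono\<close>)
  note * = exponential_functional[of "\<lambda>x. of_real (u x)", OF _ _ log AE_I2[OF int]]
  have m: "(\<lambda>\<omega>. complex_of_real (\<integral>x. u x \<partial>\<xi> \<omega>)) \<in> borel_measurable M"
    using *(1) u by simp
  from measurable_compose[OF m borel_measurable_Re] show "(\<lambda>\<omega>. \<integral>x. u x \<partial>\<xi> \<omega>) \<in> borel_measurable M" by simp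
  have "complex_of_real (\<integral>\<omega>. exp (- (\<integral>x. u x \<partial>\<xi> \<omega>)) \<partial>M) = exp (- (\<integral>x. Ln (of_real (1 + u x)) \<partial>\<alpha>))"
  proof -
    have "exp (- complex_of_real r) = of_real (exp (- r))" for r
      by (simp add: exp_of_real[symmetric])
    then show ?thesis using *(2) u by simp
  qed
  also have "(\<integral>x. Ln (of_real (1 + u x)) \<partial>\<alpha>) = (\<integral>x. of_real (ln (1 + u x)) \<partial>\<alpha>)"
    using u by (intro Bochner_Integration.integral_cong refl Ln_of_real) (simp add: add_pos_nonneg)
  also have "exp (- \<dots>) = of_real (exp (- (\<integral>x. ln (1 + u x) \<partial>\<alpha>)))"
    by (simp add: exp_of_real[symmetric])
  finally show "(\<integral>\<omega>. exp (- (\<integral>x. u x \<partial>\<xi> \<omega>)) \<partial>M) = exp (- (\<integral>x. ln (1 + u x) \<partial>\<alpha>))"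
    by (simp only: of_real_eq_iff)
qed

text \<open>
  Let \<open>I\<close> be the event that \<open>\<integral> |x| d\<xi>\<close> is finite. As \<open>n \<rightarrow> \<infinity>\<close>, \<open>exp (- \<integral> l min(|x|, n) d\<xi>)\<close> decreases to \<open>0\<close>
  off \<open>I\<close>, and to a number in \<open>[0, 1]\<close> on \<open>I\<close>. Comparing expectations gives
  \<open>exp (- \<integral> ln (1 + l |x|) d\<alpha>) \<le> P(I)\<close>, and the left-hand side tends to \<open>1\<close> as \<open>l \<rightarrow> 0\<close>.
\<close>
theorem AE_integrable_identity: "AE \<omega> in M. integrable (\<xi> \<omega>) (\<lambda>x. x)"
proof -
  define I where "I = {\<omega> \<in> space M. integrable (\<xi> \<omega>) (\<lambda>x. of_real x :: complex)}"
  have I [measurable]: "I \<in> sets M" unfolding I_def by (rule integrable_process_measurable) simp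
  have I_iff: "\<omega> \<in> I \<longleftrightarrow> integrable (\<xi> \<omega>) (\<lambda>x. \<bar>x\<bar>)" if "\<omega> \<in> space M" for \<omega>
    using that by (auto simp: I_def complex_of_real_integrable_eq measurable_process_iff
        dest: integrable_abs intro: integrable_norm_cancel[of _ "\<lambda>x. x"])
  have le: "exp (- (\<integral>x. ln (1 + l * \<bar>x\<bar>) \<partial>\<alpha>)) \<le> prob I" if l: "l > 0" for l
  proof -
    define u where "u = (\<lambda>n x. l * min \<bar>x\<bar> (real n))"
    have u [measurable]: "u n \<in> borel_measurable borel" "0 \<le> u n x" "u n x \<le> l * real n" "u n x \<le> l * \<bar>x\<bar>" for n x
      using l by (auto simp: u_def)
    have mono: "u m x \<le> u n x" if "m \<le> n" for m n x
      using that l by (auto simp: u_def)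
    have u_lim: "(\<lambda>n. u n x) \<longlonglongrightarrow> l * \<bar>x\<bar>" for x
    proof (rule tendsto_eventually)
      show "\<forall>\<^sub>F n in sequentially. u n x = l * \<bar>x\<bar>"
        using eventually_ge_at_top[of "nat \<lceil>\<bar>x\<bar>\<rceil>"]
        by eventually_elim (auto simp: u_def min_def nat_le_iff ceiling_le_iff)
    qed
    note m [measurable] = laplace_functional_bounded(1)[OF u(1) u(2) u(3)]
    note L = laplace_functional_bounded(2)[OF u(1) u(2) u(3)]
    have int: "integrable (\<xi> \<omega>) (u n)" if "\<omega> \<in> space M" for n \<omega>
      by (rule finite_measure.integrable_const_bound[OF finite_process[OF that], where B = "l * real n"])
         (use u that in \<open>auto simp: measurable_process_iff\<close>)
    have lim: "(\<lambda>n. exp (- (\<integral>x. u n x \<partial>\<xi> \<omega>))) \<longlonglongrightarrow> (if \<omega> \<in> I then exp (- (\<integral>x. l * \<bar>x\<bar> \<partial>\<xi> \<omega>)) else 0)"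
      if \<omega>: "\<omega> \<in> space M" for \<omega>
    proof (cases "\<omega> \<in> I")
      case True
      then have "integrable (\<xi> \<omega>) (\<lambda>x. l * \<bar>x\<bar>)" using I_iff[OF \<omega>] by simp
      then have "(\<lambda>n. \<integral>x. u n x \<partial>\<xi> \<omega>) \<longlonglongrightarrow> (\<integral>x. l * \<bar>x\<bar> \<partial>\<xi> \<omega>)"
        using \<omega> u_lim u by (intro integral_dominated_convergence[where w = "\<lambda>x. l * \<bar>x\<bar>"])
          (auto simp: measurable_process_iff)
      then show ?thesis using True by (auto intro!: tendsto_intros)
    next
      case False
      have inc: "incseq (\<lambda>n. \<integral>x. u n x \<partial>\<xi> \<omega>)"
        by (intro incseq_SucI integral_mono int[OF \<omega>] mono) simp
      have "\<not> bdd_above (range (\<lambda>n. \<integral>x. u n x \<partial>\<xi> \<omega>))"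
      proof
        assume "bdd_above (range (\<lambda>n. \<integral>x. u n x \<partial>\<xi> \<omega>))"
        then obtain y where "(\<lambda>n. \<integral>x. u n x \<partial>\<xi> \<omega>) \<longlonglongrightarrow> y"
          using LIMSEQ_incseq_SUP[OF _ inc] by blast
        then have "integrable (\<xi> \<omega>) (\<lambda>x. l * \<bar>x\<bar>)"
          using \<omega> u_lim mono by (intro integrable_monotone_convergence[OF int[OF \<omega>]])
            (auto simp: measurable_process_iff incseq_def mono_def)
        then show False using False l I_iff[OF \<omega>] by simp
      qed
      then have "filterlim (\<lambda>n. \<integral>x. u n x \<partial>\<xi> \<omega>) at_top sequentially"
        unfolding filterlim_at_top
      proof (intro allI)
        fix Z :: real
        assume "\<not> bdd_above (range (\<lambda>n. \<integral>x. u n x \<partial>\<xi> \<omega>))"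
        then obtain N where "(\<integral>x. u N x \<partial>\<xi> \<omega>) \<ge> Z"
          unfolding bdd_above_def using nle_le by blast
        then show "\<forall>\<^sub>F n in sequentially. Z \<le> (\<integral>x. u n x \<partial>\<xi> \<omega>)"
          using incseqD[OF inc, of N] order_trans by (intro eventually_sequentiallyI[of N]) blast
      qed
      then have "(\<lambda>n. exp (- (\<integral>x. u n x \<partial>\<xi> \<omega>))) \<longlonglongrightarrow> 0"
        by (intro filterlim_compose[OF exp_at_bot]) (simp add: filterlim_uminus_at_top[symmetric])
      then show ?thesis using False by simp
    qed
    have "(\<lambda>n. exp (- (\<integral>x. ln (1 + u n x) \<partial>\<alpha>))) \<longlonglongrightarrow> exp (- (\<integral>x. ln (1 + l * \<bar>x\<bar>) \<partial>\<alpha>))"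
    proof (intro tendsto_intros integral_dominated_convergence[where w = "\<lambda>x. ln (1 + l * \<bar>x\<bar>)"])
      show "integrable \<alpha> (\<lambda>x. ln (1 + l * \<bar>x\<bar>))" using l by (intro \<alpha>.integrable_log_scale) simp
      show "AE x in \<alpha>. (\<lambda>n. ln (1 + u n x)) \<longlonglongrightarrow> ln (1 + l * \<bar>x\<bar>)"
        using l by (intro AE_I2 tendsto_intros u_lim) (auto simp: add_nonneg_eq_0_iff)
      show "AE x in \<alpha>. norm (ln (1 + u n x)) \<le> ln (1 + l * \<bar>x\<bar>)" for n
        using u by (auto simp: add_pos_nonneg intro!: AE_I2 ln_mono)
    qed auto
    then have 1: "(\<lambda>n. \<integral>\<omega>. exp (- (\<integral>x. u n x \<partial>\<xi> \<omega>)) \<partial>M) \<longlonglongrightarrow> exp (- (\<integral>x. ln (1 + l * \<bar>x\<bar>) \<partial>\<alpha>))"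
      unfolding L .
    define D where "D = (\<lambda>\<omega>. if \<omega> \<in> I then exp (- (\<integral>x. l * \<bar>x\<bar> \<partial>\<xi> \<omega>)) else 0)"
    have D [measurable]: "D \<in> borel_measurable M"
    proof (rule borel_measurable_LIMSEQ_metric[where f = "\<lambda>n \<omega>. exp (- (\<integral>x. u n x \<partial>\<xi> \<omega>))"])
      show "(\<lambda>n. exp (- (\<integral>x. u n x \<partial>\<xi> \<omega>))) \<longlonglongrightarrow> D \<omega>" if "\<omega> \<in> space M" for \<omega>
        using lim[OF that] by (simp only: D_def)
    qed measurable
    have D_le: "0 \<le> D \<omega>" "D \<omega> \<le> indicator I \<omega>" for \<omega>
    proof -
      have "(\<integral>x. l * \<bar>x\<bar> \<partial>\<xi> \<omega>) \<ge> 0" using l by (intro integral_nonneg_AE AE_I2) simp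
      then show "0 \<le> D \<omega>" "D \<omega> \<le> indicator I \<omega>" by (simp_all add: D_def)
    qed
    have "(\<lambda>n. \<integral>\<omega>. exp (- (\<integral>x. u n x \<partial>\<xi> \<omega>)) \<partial>M) \<longlonglongrightarrow> (\<integral>\<omega>. D \<omega> \<partial>M)"
    proof (rule integral_dominated_convergence[where w = "\<lambda>_. 1"])
      show "AE \<omega> in M. (\<lambda>n. exp (- (\<integral>x. u n x \<partial>\<xi> \<omega>))) \<longlonglongrightarrow> D \<omega>"
        using lim by (intro AE_I2) (simp only: D_def)
      show "AE \<omega> in M. norm (exp (- (\<integral>x. u n x \<partial>\<xi> \<omega>))) \<le> 1" for n
      proof (rule AE_I2)
        fix \<omega>
        have "(\<integral>x. u n x \<partial>\<xi> \<omega>) \<ge> 0" by (intro integral_nonneg_AE AE_I2 u)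
        then show "norm (exp (- (\<integral>x. u n x \<partial>\<xi> \<omega>))) \<le> 1" by simp
      qed
    qed simp_all
    with 1 have "exp (- (\<integral>x. ln (1 + l * \<bar>x\<bar>) \<partial>\<alpha>)) = (\<integral>\<omega>. D \<omega> \<partial>M)"
      by (rule LIMSEQ_unique)
    also have "\<dots> \<le> (\<integral>\<omega>. indicator I \<omega> \<partial>M)"
    proof (rule integral_mono[OF _ _ D_le(2)])
      show I_int: "integrable M (\<lambda>\<omega>. indicator I \<omega> :: real)" by (simp add: emeasure_eq_measure)
      show "integrable M D"
        by (rule Bochner_Integration.integrable_bound[OF I_int D]) (use D_le in auto)
    qed
    also have "\<dots> = prob I" by simp
    finally show ?thesis .
  qed
  have "(\<lambda>k. exp (- (\<integral>x. ln (1 + 1 / real (Suc k) * \<bar>x\<bar>) \<partial>\<alpha>))) \<longlonglongrightarrow> exp (- (\<integral>x. 0 \<partial>\<alpha>))"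
  proof (intro tendsto_intros integral_dominated_convergence[where w = "\<lambda>x. ln (1 + \<bar>x\<bar>)"])
    show "integrable \<alpha> (\<lambda>x. ln (1 + \<bar>x\<bar>))" by (rule \<alpha>.integrable_log)
    show "AE x in \<alpha>. (\<lambda>k. ln (1 + 1 / real (Suc k) * \<bar>x\<bar>)) \<longlonglongrightarrow> 0"
      by (intro AE_I2) real_asymp
    show "AE x in \<alpha>. norm (ln (1 + 1 / real (Suc k) * \<bar>x\<bar>)) \<le> ln (1 + \<bar>x\<bar>)" for k
      by (auto simp: add_pos_nonneg field_simps mult_right_mono intro!: AE_I2 ln_mono)
  qed auto
  then have lim1: "(\<lambda>k. exp (- (\<integral>x. ln (1 + 1 / real (Suc k) * \<bar>x\<bar>) \<partial>\<alpha>))) \<longlonglongrightarrow> 1"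
    by (simp only: Bochner_Integration.integral_zero minus_zero exp_zero)
  have "1 \<le> prob I"
    by (rule LIMSEQ_le_const2[OF lim1], intro exI allI impI, rule le) simp
  then have "prob I = 1" using prob_le_1[of I] by linarith
  then have "AE \<omega> in M. \<omega> \<in> I" using prob_eq_1[OF I] by blast
  then show ?thesis
  proof (rule AE_mp, intro AE_I2 impI)
    fix \<omega> assume "\<omega> \<in> I"
    then show "integrable (\<xi> \<omega>) (\<lambda>x. x)" unfolding I_def complex_of_real_integrable_eq by simp
  qed
qed

theorem identity_integral_cf_eq:
  "identity_integral_cf M \<xi> t = exp (- \<alpha>.log_exponent t)"
proof -
  have "(\<integral>\<omega>. exp (- (\<integral>x. - (\<i> * of_real (t * x)) \<partial>\<xi> \<omega>)) \<partial>M)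
      = exp (- (\<integral>x. Ln (1 + - (\<i> * of_real (t * x))) \<partial>\<alpha>))"
  proof (rule exponential_functional(2))
    show "integrable \<alpha> (\<lambda>x. ln (1 + norm (- (\<i> * of_real (t * x)))))"
      using \<alpha>.integrable_log_scale[of "\<bar>t\<bar>"] by (simp add: norm_mult abs_mult)
    show "AE \<omega> in M. integrable (\<xi> \<omega>) (\<lambda>x. - (\<i> * of_real (t * x)))"
      using AE_integrable_identity
      by eventually_elim (auto simp: complex_of_real_integrable_eq)
  qed auto
  moreover have "exp (- (\<integral>x. - (\<i> * of_real (t * x)) \<partial>\<xi> \<omega>)) = iexp (t * identity_integral \<xi> \<omega>)" for \<omega>
    by (simp add: identity_integral_def)
  ultimately show ?thesis by (simp add: identity_integral_cf_def \<alpha>.log_exponent_def)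
qed

end

section \<open>Stieltjes measures and the Levy density\<close>

lemma (in finite_borel_measure) interval_measure_cdf: "interval_measure (cdf M) = M"
proof -
  note cdf = cdf_nondecreasing cdf_is_right_cont cdf_lim_at_bot
  have "finite_borel_measure (interval_measure (cdf M))"
    by (rule finite_borel_measure_interval_measure[OF cdf cdf_lim_at_top]) auto
  then show ?thesis
    by (rule cdf_unique'[OF _ finite_borel_measure_axioms cdf_interval_measure[OF cdf]])
qed

lemma interval_measure_add_const: "interval_measure (\<lambda>x. c + F x) = interval_measure F"
  by (simp add: interval_measure_def)

text \<open>
  The functions met below are left-continuous, with values \<open>c + M (- \<infinity>, z)\<close>; the right limits in the
  definition of the Stieltjes measure turn these into \<open>c + M (- \<infinity>, y]\<close>. The extension beyond \<open>S\<close> is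
  consistent with this because \<open>M\<close> has no mass outside \<open>S\<close>.
\<close>
lemma (in finite_borel_measure) stieltjes_measure_on_eq:
  assumes S: "open S" "S \<noteq> {}" and null: "measure M (- S) = 0"
    and F: "\<And>z. z \<in> S \<Longrightarrow> F z = c + measure M {..<z}"
  shows "stieltjes_measure_on S F = M"
proof -
  have mono: "measure M A \<le> measure M B" if "A \<subseteq> B" "A \<in> sets borel" "B \<in> sets borel" for A B
    using that by (intro finite_measure_mono) auto
  have within_S: "measure M A = measure M B" if "A \<subseteq> B" "B - A \<subseteq> - S" "A \<in> sets borel" "B \<in> sets borel" for A B
  proof -
    have "measure M (B - A) \<le> measure M (- S)" using that S by (intro mono) auto
    then have "measure M (B - A) = 0" using null by (simp add: measure_le_0_iff)
    moreover have "measure M (B - A) = measure M B - measure M A"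
      using that by (intro finite_measure_Diff) auto
    ultimately show ?thesis by simp
  qed
  have "(if \<exists>z\<in>S. y < z then Inf (F ` (S \<inter> {y<..})) else Sup (F ` S)) = c + cdf M y" for y
  proof (cases "\<exists>z\<in>S. y < z")
    case True
    define T where "T = S \<inter> {y<..}"
    have T: "T \<noteq> {}" "open T" "bdd_below T"
      using True S by (auto simp: T_def bdd_below_def intro: less_imp_le)
    define m where "m = Inf T"
    have ym: "y \<le> m" unfolding m_def using T(1) by (intro cInf_greatest) (auto simp: T_def)
    have m_le: "m \<le> z" if "z \<in> T" for z unfolding m_def using that T by (intro cInf_lower)
    have "m \<notin> T"
    proof
      assume "m \<in> T"
      then obtain e where "e > 0" "ball m e \<subseteq> T" using T(2) openE by blast
      then have "m - e/2 \<in> T" by (auto simp: dist_real_def subset_iff)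
      from m_le[OF this] \<open>e > 0\<close> show False by simp
    qed
    have cdf_m: "cdf M m = cdf M y"
    proof -
      have "{..m} - {..y} \<subseteq> - S"
      proof (intro subsetI ComplI)
        fix x assume "x \<in> {..m} - {..y}" "x \<in> S"
        then have "x \<in> T" "x \<le> m" by (auto simp: T_def)
        with m_le[of x] \<open>m \<notin> T\<close> show False by simp
      qed
      then show ?thesis
        unfolding cdf_def2 using ym by (intro within_S[symmetric]) auto
    qed
    have "Inf (F ` T) = c + cdf M m"
    proof (rule cInf_eq_non_empty)
      show "c + cdf M m \<le> x" if "x \<in> F ` T" for x
      proof -
        from that obtain z where z: "z \<in> T" "x = F z" by auto
        have "m < z" using m_le[OF z(1)] \<open>m \<notin> T\<close> z(1) by (cases "m = z") auto
        then have "measure M {..m} \<le> measure M {..<z}" by (intro mono) auto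
        then show ?thesis using z F by (simp add: T_def cdf_def2)
      qed
      show "y \<le> c + cdf M m" if "\<And>x. x \<in> F ` T \<Longrightarrow> y \<le> x" for y
      proof (rule field_le_epsilon)
        fix e :: real assume "e > 0"
        have "(cdf M \<longlongrightarrow> cdf M m) (at_right m)"
          using cdf_is_right_cont[of m] by (simp add: continuous_within)
        then have "\<forall>\<^sub>F z in at_right m. cdf M z < cdf M m + e"
          using \<open>e > 0\<close> by (intro order_tendstoD) auto
        then obtain b where b: "b > m" "\<And>z. m < z \<Longrightarrow> z < b \<Longrightarrow> cdf M z < cdf M m + e"
          by (auto simp: eventually_at_right_field)
        obtain z where z: "z \<in> T" "z < b"
          using b(1) cInf_lessD[OF T(1), of b] by (auto simp: m_def)
        have "m < z" using m_le[OF z(1)] \<open>m \<notin> T\<close> z(1) by (cases "m = z") auto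
        have "y \<le> F z" using that z by auto
        also have "\<dots> = c + measure M {..<z}" using F z by (simp add: T_def)
        also have "measure M {..<z} \<le> cdf M z" unfolding cdf_def2 by (intro mono) auto
        finally show "y \<le> c + cdf M m + e" using b(2)[OF \<open>m < z\<close> z(2)] by simp
      qed
    qed (use T in simp)
    then show ?thesis using True by (simp add: T_def cdf_m)
  next
    case False
    then have Sy: "S \<subseteq> {..y}" by (auto simp: not_less)
    have cdf_y: "cdf M y = measure M UNIV"
      unfolding cdf_def2 using Sy by (intro within_S) auto
    have "Sup (F ` S) = c + measure M UNIV"
    proof (rule cSup_eq_non_empty)
      show "x \<le> c + measure M UNIV" if "x \<in> F ` S" for x
        using that F by (auto intro!: mono)
      show "c + measure M UNIV \<le> b" if "\<And>x. x \<in> F ` S \<Longrightarrow> x \<le> b" for b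
      proof -
        define m where "m = Sup S"
        have bdd: "bdd_above S" using Sy by (auto simp: bdd_above_def)
        have le_m: "z \<le> m" if "z \<in> S" for z unfolding m_def using that bdd by (intro cSup_upper)
        have "m \<notin> S"
        proof
          assume "m \<in> S"
          then obtain e where "e > 0" "ball m e \<subseteq> S" using S(1) openE by blast
          then have "m + e/2 \<in> S" by (auto simp: dist_real_def subset_iff)
          from le_m[OF this] \<open>e > 0\<close> show False by simp
        qed
        have Sm: "S \<subseteq> {..<m}" using le_m \<open>m \<notin> S\<close> by (force simp: less_le)
        have eq: "measure M {..<m} = measure M UNIV"
          using Sm by (intro within_S) auto
        have "measure M {..<m} \<le> b - c"
        proof (rule tendsto_upperbound[OF cdf_at_left])
          show "\<forall>\<^sub>F z in at_left m. cdf M z \<le> b - c"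
            unfolding eventually_at_filter
          proof (intro always_eventually allI impI)
            fix z assume "z \<in> {..<m}"
            then obtain w where w: "w \<in> S" "z < w" using less_cSupD[OF S(2), of z] by (auto simp: m_def)
            have "cdf M z \<le> measure M {..<w}" unfolding cdf_def2 using w by (intro mono) auto
            also have "\<dots> \<le> b - c" using that[OF imageI[OF w(1)]] F[OF w(1)] by linarith
            finally show "cdf M z \<le> b - c" .
          qed
        qed simp
        then show ?thesis using eq by simp
      qed
    qed (use S in simp)
    then show ?thesis using False by (simp add: cdf_y)
  qed
  then have "stieltjes_measure_on S F = interval_measure (\<lambda>y. c + cdf M y)"
    unfolding stieltjes_measure_on_def by simp
  then show ?thesis by (simp add: interval_measure_add_const interval_measure_cdf)
qed

context log_finite_measure
begin

text \<open>
  Change of variables \<open>u = 1 / y\<close>, which maps each half-line to itself and reverses its order: the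
  Stieltjes measure of \<open>- A(1 / y)\<close> is the image under inversion of \<open>\<alpha>\<close> restricted to \<open>S\<close>.
\<close>
lemma decreasing_stieltjes_integral_cdf_inverse:
  assumes S: "S = {0<..} \<or> S = {..<0}" and [measurable]: "h \<in> borel_measurable borel"
  shows "decreasing_stieltjes_integral S h (\<lambda>y. cdf \<alpha> (inverse y))
    = - (\<integral>u. indicator S u * h (inverse u) \<partial>\<alpha>)"
proof -
  define N where "N = distr (density \<alpha> (\<lambda>u. indicator S u)) borel (inverse :: real \<Rightarrow> real)"
  have S': "open S" "S \<noteq> {}" "S \<in> sets borel"
    using S by (metis open_greaterThan open_lessThan greaterThan_non_empty lessThan_non_empty
        greaterThan_borel lessThan_borel)+
  have inv_S: "inverse u \<in> S \<longleftrightarrow> u \<in> S" for u using S by auto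
  have emeasure_N: "emeasure N A = emeasure \<alpha> {u \<in> S. inverse u \<in> A}" if [measurable]: "A \<in> sets borel" for A
  proof -
    have "emeasure N A = emeasure (density \<alpha> (\<lambda>u. indicator S u)) (inverse -` A)"
      by (simp add: N_def emeasure_distr)
    also have "\<dots> = (\<integral>\<^sup>+u. indicator S u * indicator (inverse -` A) u \<partial>\<alpha>)"
      using S'(3) measurable_sets[of inverse borel borel A] by (intro emeasure_density) auto
    also have "\<dots> = (\<integral>\<^sup>+u. indicator {u \<in> S. inverse u \<in> A} u \<partial>\<alpha>)"
      by (intro nn_integral_cong) (auto split: split_indicator)
    also have "\<dots> = emeasure \<alpha> {u \<in> S. inverse u \<in> A}"
    proof (rule nn_integral_indicator)
      have "{u \<in> S. inverse u \<in> A} = S \<inter> (inverse -` A \<inter> space borel)" by auto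
      then show "{u \<in> S. inverse u \<in> A} \<in> sets \<alpha>"
        using S'(3) measurable_sets[of inverse borel borel A] that by simp
    qed
    finally show ?thesis .
  qed
  then have measure_N: "measure N A = measure \<alpha> {u \<in> S. inverse u \<in> A}" if "A \<in> sets borel" for A
    using that by (simp add: measure_def)
  interpret N: finite_borel_measure N
  proof (intro finite_borel_measure.intro finite_measureI finite_borel_measure_axioms.intro)
    show "emeasure N (space N) \<noteq> \<infinity>" using emeasure_N[of UNIV] by (simp add: N_def emeasure_eq_measure)
    show "sets N = sets borel" by (simp add: N_def)
  qed
  have meas [measurable]: "{..x} \<in> sets \<alpha>" "{x<..} \<in> sets \<alpha>" "{x<..<y} \<in> sets \<alpha>" "{..<x} \<in> sets \<alpha>" for x y by auto
  have "\<exists>c. \<forall>z\<in>S. - cdf \<alpha> (inverse z) = c + measure N {..<z}"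
    using S
  proof
    assume S: "S = {0<..}"
    have "- cdf \<alpha> (inverse z) = - measure \<alpha> UNIV + measure N {..<z}" if "z \<in> S" for z
    proof -
      have z: "z > 0" using that S by simp
      have "inverse u < z \<longleftrightarrow> inverse z < u" if "u > 0" for u
        using that z by (auto simp: field_simps)
      moreover have "u > 0" if "inverse z < u" for u
        using that z by (meson inverse_positive_iff_positive less_trans)
      ultimately have "{u \<in> S. inverse u \<in> {..<z}} = UNIV - {..inverse z}"
        using S by auto
      then show ?thesis
        using finite_measure_compl[of "{..inverse z}"] by (simp add: measure_N cdf_def2)
    qed
    then show ?thesis by blast
  next
    assume S: "S = {..<0}"
    have "- cdf \<alpha> (inverse z) = - measure \<alpha> {..<0} + measure N {..<z}" if "z \<in> S" for z
    proof -
      have z: "z < 0" using that S by simp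
      have "inverse u < z \<longleftrightarrow> inverse z < u" if "u < 0" for u
        using that z by (auto simp: field_simps)
      then have "{u \<in> S. inverse u \<in> {..<z}} = {..<0} - {..inverse z}"
        using S by auto
      moreover have "{..inverse z} \<subseteq> {..<0}"
        using z by (auto intro: le_less_trans)
      ultimately show ?thesis
        using finite_measure_Diff[of "{..<0}" "{..inverse z}"]
        by (subst measure_N) (simp_all add: cdf_def2)
    qed
    then show ?thesis by blast
  qed
  then obtain c where c: "\<And>z. z \<in> S \<Longrightarrow> - cdf \<alpha> (inverse z) = c + measure N {..<z}" by blast
  have null: "measure N (- S) = 0"
  proof -
    have "{u \<in> S. inverse u \<in> - S} = {}" using inv_S by auto
    then have "measure \<alpha> {u \<in> S. inverse u \<in> - S} = 0" by (simp only: measure_empty)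
    then show ?thesis using measure_N[OF borel_comp[OF S'(3)]] by simp
  qed
  have "stieltjes_measure_on S (\<lambda>y. - cdf \<alpha> (inverse y)) = N"
    by (rule N.stieltjes_measure_on_eq[OF S'(1,2) null c])
  moreover have "(LINT y:S|N. h y) = (\<integral>u. indicator S u * h (inverse u) \<partial>\<alpha>)"
  proof -
    note [measurable] = S'(3)
    have "(LINT y:S|N. h y) = (\<integral>u. indicator S (inverse u) *\<^sub>R h (inverse u) \<partial>density \<alpha> (\<lambda>u. indicator S u))"
      unfolding set_lebesgue_integral_def N_def by (subst integral_distr) auto
    also have "\<dots> = (\<integral>u. indicator S (inverse u) *\<^sub>R h (inverse u) \<partial>density \<alpha> (\<lambda>u. ennreal (indicator S u)))"
      by (simp add: ennreal_indicator)
    also have "\<dots> = (\<integral>u. indicator S u *\<^sub>R (indicator S (inverse u) *\<^sub>R h (inverse u)) \<partial>\<alpha>)"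
      by (subst integral_density) auto
    also have "\<dots> = (\<integral>u. indicator S u * h (inverse u) \<partial>\<alpha>)"
      by (intro Bochner_Integration.integral_cong) (auto simp: indicator_def inv_S)
    finally show ?thesis .
  qed
  ultimately show ?thesis by (simp add: decreasing_stieltjes_integral_def)
qed

text \<open>
  The Levy density of the integral of the identity is \<open>exponential_mixture x / |x|\<close>. The indicator
  selects the \<open>u\<close> of the same sign as \<open>x\<close>, so that both half-lines are treated by one formula.
\<close>
definition exponential_mixture :: "real \<Rightarrow> real" where
  "exponential_mixture x = (\<integral>u. indicator {0<..} (x * u) * exp (- x / u) \<partial>\<alpha>)"

lemma exponential_mixture_nonneg: "exponential_mixture x \<ge> 0"
  unfolding exponential_mixture_def by (intro integral_nonneg_AE) auto

lemma g_density_eq: "g_density \<alpha> x = \<bar>x\<bar> / (1 + x\<^sup>2) * exponential_mixture x"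
proof -
  have "g_density \<alpha> x = \<bar>x\<bar> / (1 + x\<^sup>2) *
      (indicator {0..} x * (\<integral>u. indicator {0<..} u * exp (- inverse u * x) \<partial>\<alpha>)
       + indicator {..<0} x * (\<integral>u. indicator {..<0} u * exp (- inverse u * x) \<partial>\<alpha>))"
    unfolding g_density_def by (subst (1 2) decreasing_stieltjes_integral_cdf_inverse) (auto simp: algebra_simps)
  moreover have "(\<integral>u. indicator {0<..} u * exp (- inverse u * x) \<partial>\<alpha>) = exponential_mixture x" if "x > 0"
    unfolding exponential_mixture_def using that
    by (intro Bochner_Integration.integral_cong) (auto simp: indicator_def zero_less_mult_iff divide_inverse mult.commute)
  moreover have "(\<integral>u. indicator {..<0} u * exp (- inverse u * x) \<partial>\<alpha>) = exponential_mixture x" if "x < 0"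
    unfolding exponential_mixture_def using that
    by (intro Bochner_Integration.integral_cong) (auto simp: indicator_def zero_less_mult_iff divide_inverse mult.commute)
  ultimately show ?thesis by (cases x "0::real" rule: linorder_cases) auto
qed

end

section \<open>The Levy-Khintchine representation\<close>

lemma rational_le_exp:
  fixes r :: real
  assumes "r \<ge> 0"
  shows "r / (1 + r\<^sup>2) \<le> 2 * (1 - exp (- r))" "r\<^sup>2 / (1 + r\<^sup>2) \<le> 2 * (1 - exp (- r))"
proof -
  have "exp (- r) \<le> 1 / (1 + r)"
    using exp_ge_add_one_self[of r] assms by (simp add: exp_minus field_simps)
  then have 1: "2 * (r / (1 + r)) \<le> 2 * (1 - exp (- r))" using assms by (simp add: field_simps)
  have pos: "1 + r\<^sup>2 > 0" "1 + r > 0" using assms by (auto intro: add_pos_nonneg)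
  have sq: "2 * r \<le> 1 + r\<^sup>2" using sum_power2_ge_zero[of "r - 1" 0] by (simp add: power2_eq_square algebra_simps)
  have "1 + r \<le> 2 * (1 + r\<^sup>2)" using sq zero_le_power2[of r] assms by (smt (verit))
  from mult_left_mono[OF this assms] have "r * (1 + r) \<le> r * (2 * (1 + r\<^sup>2))" .
  then have "r / (1 + r\<^sup>2) \<le> 2 * (r / (1 + r))" using pos by (simp add: divide_simps mult_ac)
  then show "r / (1 + r\<^sup>2) \<le> 2 * (1 - exp (- r))" using 1 by linarith
  have "r * (1 + r) = r + r\<^sup>2" by (simp add: power2_eq_square algebra_simps)
  then have "r * (1 + r) \<le> 2 * (1 + r\<^sup>2)" using sq zero_le_power2[of r] assms by (smt (verit))
  from mult_left_mono[OF this assms]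
  have "r\<^sup>2 * (1 + r) \<le> 2 * r * (1 + r\<^sup>2)" by (simp add: power2_eq_square mult_ac)
  then have "r\<^sup>2 / (1 + r\<^sup>2) \<le> 2 * (r / (1 + r))" using pos by (simp add: divide_simps mult_ac)
  then show "r\<^sup>2 / (1 + r\<^sup>2) \<le> 2 * (1 - exp (- r))" using 1 by linarith
qed

text \<open>
  The substitution \<open>x = u s\<close>. For \<open>u = 0\<close> both integrands vanish identically, on the left because of the
  indicator and on the right because of the factor \<open>|u|\<close>.
\<close>
lemma scaled_exponential_integral:
  fixes h :: "real \<Rightarrow> complex"
  shows "(\<integral>x. (indicator {0<..} (x * u) * exp (- x / u)) *\<^sub>R h x \<partial>lborel)
    = (\<integral>s. (indicator {0<..} s * exp (- s)) *\<^sub>R (of_real \<bar>u\<bar> * h (u * s)) \<partial>lborel)" (is ?eq)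
    and "integrable lborel (\<lambda>x. (indicator {0<..} (x * u) * exp (- x / u)) *\<^sub>R h x)
    \<longleftrightarrow> integrable lborel (\<lambda>s. (indicator {0<..} s * exp (- s)) *\<^sub>R (of_real \<bar>u\<bar> * h (u * s)))" (is ?iff)
proof -
  let ?k = "\<lambda>x. (indicator {0<..} (x * u) * exp (- x / u)) *\<^sub>R h x"
  have "?eq \<and> ?iff"
  proof (cases "u = 0")
    case False
    have *: "(indicator {0<..} s * exp (- s)) *\<^sub>R (of_real \<bar>u\<bar> * h (u * s)) = \<bar>u\<bar> *\<^sub>R ?k (0 + u * s)" for s
    proof -
      have "u * s * u > 0 \<longleftrightarrow> s > 0"
        using False by (metis mult.commute mult.left_commute not_real_square_gt_zero zero_less_mult_pos2 mult_pos_pos)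
      then show ?thesis using False by (simp add: scaleR_conv_of_real indicator_def)
    qed
    have ?eq
      using lborel_integral_real_affine[OF False, of ?k 0]
      by (simp only: * Bochner_Integration.integral_scaleR_right)
    moreover have ?iff
    proof -
      have "integrable lborel (\<lambda>s. \<bar>u\<bar> *\<^sub>R f s) \<longleftrightarrow> integrable lborel f" for f :: "real \<Rightarrow> complex"
        using integrable_scaleR_right[of "inverse \<bar>u\<bar>" lborel "\<lambda>s. \<bar>u\<bar> *\<^sub>R f s"] False
        by (auto intro: integrable_scaleR_right)
      then show ?thesis
        using lborel_integrable_real_affine_iff[OF False, of ?k 0] by (simp only: *)
    qed
    ultimately show ?thesis by simp
  qed simp
  then show ?eq ?iff by auto
qed

context log_finite_measure
begin

text \<open>
  Integrals against the mixture reduce to integrals against \<open>\<alpha>\<close>. After the substitution \<open>x = u s\<close> the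
  hypothesis on \<open>h\<close> bounds the inner integrand by \<open>C\<close> times a Frullani integrand with parameter \<open>c |u|\<close>,
  whose integral \<open>ln (1 + c |u|)\<close> is \<open>\<alpha>\<close>-integrable; this justifies Fubini. The three integrands of the
  Levy-Khintchine formula all satisfy the hypothesis.
\<close>
theorem integral_exponential_mixture:
  fixes h :: "real \<Rightarrow> complex"
  assumes [measurable]: "h \<in> borel_measurable borel"
    and c: "c \<ge> 0" and h: "\<And>x. \<bar>x\<bar> * norm (h x) \<le> C * (1 - exp (- (c * \<bar>x\<bar>)))"
  shows "integrable lborel (\<lambda>x. exponential_mixture x *\<^sub>R h x)"
    and "(\<integral>x. exponential_mixture x *\<^sub>R h x \<partial>lborel)
      = (\<integral>u. \<integral>s. (indicator {0<..} s * exp (- s)) *\<^sub>R (of_real \<bar>u\<bar> * h (u * s)) \<partial>lborel \<partial>\<alpha>)"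
proof -
  define k where "k = (\<lambda>u x. (indicator {0<..} (x * u) * exp (- x / u)) *\<^sub>R h x)"
  define k' where "k' = (\<lambda>u s. (indicator {0<..} s * exp (- s)) *\<^sub>R (of_real \<bar>u\<bar> * h (u * s)))"
  define w where "w = (\<lambda>u s. C * (indicator {0<..} s * ((1 - exp (- (c * \<bar>u\<bar>) * s)) * (exp (- s) / s))))"
  interpret P: pair_sigma_finite \<alpha> lborel ..
  have k [measurable]: "case_prod k \<in> borel_measurable (\<alpha> \<Otimes>\<^sub>M lborel)"
    unfolding k_def by measurable
  have k'_le: "norm (k' u s) \<le> w u s" for u s
  proof (cases "s > 0")
    case True
    have "norm (k' u s) = (\<bar>u * s\<bar> * norm (h (u * s))) * (exp (- s) / s)"
      using True by (simp add: k'_def norm_mult abs_mult)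
    also have "\<dots> \<le> (C * (1 - exp (- (c * \<bar>u * s\<bar>)))) * (exp (- s) / s)"
      using True by (intro mult_right_mono h) auto
    also have "\<dots> = w u s" using True by (simp add: w_def abs_mult mult.assoc)
    finally show ?thesis .
  qed (simp add: k'_def w_def)
  have w: "integrable lborel (w u)" "(\<integral>s. w u s \<partial>lborel) = C * ln (1 + c * \<bar>u\<bar>)" for u
  proof -
    have cu: "c * \<bar>u\<bar> \<ge> 0" using c by simp
    show "integrable lborel (w u)"
      unfolding w_def by (intro integrable_mult_right frullani_real(1)[OF cu])
    show "(\<integral>s. w u s \<partial>lborel) = C * ln (1 + c * \<bar>u\<bar>)"
      unfolding w_def by (simp only: Bochner_Integration.integral_mult_right_zero frullani_real(2)[OF cu])
  qed
  have k'_int: "integrable lborel (k' u)" for u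
  proof (rule Bochner_Integration.integrable_bound[OF w(1)])
    show "k' u \<in> borel_measurable lborel" unfolding k'_def by measurable
    show "AE s in lborel. norm (k' u s) \<le> norm (w u s)"
      using order_trans[OF k'_le abs_ge_self] by auto
  qed
  have k_int: "integrable lborel (k u)" for u
    using k'_int[of u] unfolding k_def k'_def scaled_exponential_integral(2) .
  have "(\<integral>x. norm (k u x) \<partial>lborel) \<le> C * ln (1 + c * \<bar>u\<bar>)" for u
  proof -
    have "complex_of_real (\<integral>x. norm (k u x) \<partial>lborel)
        = (\<integral>x. (indicator {0<..} (x * u) * exp (- x / u)) *\<^sub>R complex_of_real (norm (h x)) \<partial>lborel)"
      by (subst integral_complex_of_real[symmetric], intro Bochner_Integration.integral_cong)
         (simp_all add: k_def scaleR_conv_of_real norm_mult)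
    also have "\<dots> = (\<integral>s. (indicator {0<..} s * exp (- s)) *\<^sub>R (of_real \<bar>u\<bar> * of_real (norm (h (u * s)))) \<partial>lborel)"
      by (rule scaled_exponential_integral(1))
    also have "\<dots> = complex_of_real (\<integral>s. norm (k' u s) \<partial>lborel)"
      by (subst integral_complex_of_real[symmetric], intro Bochner_Integration.integral_cong)
         (simp_all add: k'_def scaleR_conv_of_real norm_mult)
    finally have "(\<integral>x. norm (k u x) \<partial>lborel) = (\<integral>s. norm (k' u s) \<partial>lborel)"
      by (simp only: of_real_eq_iff)
    also have "\<dots> \<le> (\<integral>s. w u s \<partial>lborel)"
      by (intro integral_mono integrable_norm k'_int w k'_le)
    finally show ?thesis by (simp add: w)
  qed
  note norm_k_le = this
  have int: "integrable (\<alpha> \<Otimes>\<^sub>M lborel) (case_prod k)"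
  proof (rule P.Fubini_integrable[OF k])
    show "integrable \<alpha> (\<lambda>u. \<integral>x. norm (case (u, x) of (u, x) \<Rightarrow> k u x) \<partial>lborel)"
    proof (rule Bochner_Integration.integrable_bound)
      show "integrable \<alpha> (\<lambda>u. C * ln (1 + c * \<bar>u\<bar>))"
        using integrable_log_scale[OF c] by simp
      show "AE u in \<alpha>. norm (\<integral>x. norm (case (u, x) of (u, x) \<Rightarrow> k u x) \<partial>lborel) \<le> norm (C * ln (1 + c * \<bar>u\<bar>))"
        using order_trans[OF norm_k_le abs_ge_self] by (intro AE_I2) simp
      show "(\<lambda>u. \<integral>x. norm (case (u, x) of (u, x) \<Rightarrow> k u x) \<partial>lborel) \<in> borel_measurable \<alpha>"
        using k by measurable
    qed
    show "AE u in \<alpha>. integrable lborel (\<lambda>x. case (u, x) of (u, x) \<Rightarrow> k u x)"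
      using k_int by simp
  qed
  have mix: "(\<integral>u. k u x \<partial>\<alpha>) = exponential_mixture x *\<^sub>R h x" for x
  proof -
    have "integrable \<alpha> (\<lambda>u. indicator {0<..} (x * u) * exp (- x / u))"
    proof (rule integrable_const_bound[where B = 1])
      show "AE u in \<alpha>. norm (indicator {0<..} (x * u) * exp (- x / u)) \<le> 1"
        by (intro AE_I2) (auto simp: indicator_def zero_less_mult_iff divide_nonneg_neg divide_nonpos_nonneg divide_nonneg_nonneg divide_nonpos_neg)
    qed measurable
    then show ?thesis unfolding k_def exponential_mixture_def by (intro integral_scaleR_left)
  qed
  show "integrable lborel (\<lambda>x. exponential_mixture x *\<^sub>R h x)"
    using P.integrable_snd[OF int] unfolding mix .
  have "(\<integral>x. exponential_mixture x *\<^sub>R h x \<partial>lborel) = (\<integral>x. \<integral>u. k u x \<partial>\<alpha> \<partial>lborel)"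
    by (simp only: mix)
  also have "\<dots> = (\<integral>u. \<integral>x. k u x \<partial>lborel \<partial>\<alpha>)"
    by (rule P.Fubini_integral[OF int])
  also have "\<dots> = (\<integral>u. \<integral>s. k' u s \<partial>lborel \<partial>\<alpha>)"
    unfolding k_def k'_def scaled_exponential_integral(1) ..
  finally show "(\<integral>x. exponential_mixture x *\<^sub>R h x \<partial>lborel)
      = (\<integral>u. \<integral>s. (indicator {0<..} s * exp (- s)) *\<^sub>R (of_real \<bar>u\<bar> * h (u * s)) \<partial>lborel \<partial>\<alpha>)"
    by (simp only: k'_def)
qed

theorem integrable_g_density: "integrable lborel (g_density \<alpha>)"
proof -
  have "integrable lborel (\<lambda>x. exponential_mixture x *\<^sub>R complex_of_real (\<bar>x\<bar> / (1 + x\<^sup>2)))"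
  proof (rule integral_exponential_mixture(1)[where c = 1 and C = 2])
    fix x :: real
    have "1 + x\<^sup>2 > 0" by (simp add: add_pos_nonneg)
    then have "\<bar>x\<bar> * norm (complex_of_real (\<bar>x\<bar> / (1 + x\<^sup>2))) = \<bar>x\<bar>\<^sup>2 / (1 + \<bar>x\<bar>\<^sup>2)"
      unfolding norm_of_real by (simp add: abs_divide power2_eq_square)
    then show "\<bar>x\<bar> * norm (complex_of_real (\<bar>x\<bar> / (1 + x\<^sup>2))) \<le> 2 * (1 - exp (- (1 * \<bar>x\<bar>)))"
      using rational_le_exp(2)[of "\<bar>x\<bar>"] by simp
  qed auto
  also have "(\<lambda>x. exponential_mixture x *\<^sub>R complex_of_real (\<bar>x\<bar> / (1 + x\<^sup>2))) = (\<lambda>x. complex_of_real (g_density \<alpha> x))"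
    by (simp add: g_density_eq fun_eq_iff scaleR_conv_of_real mult.commute)
  finally show ?thesis unfolding complex_of_real_integrable_eq .
qed

text \<open>
  The integrand of \<open>\<gamma>\<close>, in a form that needs no exclusion of \<open>0\<close>.
\<close>
lemma centering_integrand_eq:
  "indicator (UNIV - {0}) x *\<^sub>R (inverse x * g_density \<alpha> x) = exponential_mixture x * (sgn x / (1 + x\<^sup>2))"
  by (simp add: g_density_eq sgn_real_def indicator_def divide_inverse)

lemma integrable_centering: "integrable lborel (\<lambda>x. exponential_mixture x * (sgn x / (1 + x\<^sup>2)))"
proof -
  have "integrable lborel (\<lambda>x. exponential_mixture x *\<^sub>R complex_of_real (sgn x / (1 + x\<^sup>2)))"
  proof (rule integral_exponential_mixture(1)[where c = 1 and C = 2])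
    fix x :: real
    have "\<bar>x\<bar> * norm (complex_of_real (sgn x / (1 + x\<^sup>2))) = \<bar>x\<bar> / (1 + \<bar>x\<bar>\<^sup>2)"
      unfolding norm_of_real by (auto simp: sgn_real_def abs_divide)
    then show "\<bar>x\<bar> * norm (complex_of_real (sgn x / (1 + x\<^sup>2))) \<le> 2 * (1 - exp (- (1 * \<bar>x\<bar>)))"
      using rational_le_exp(1)[of "\<bar>x\<bar>"] by simp
  qed auto
  also have "(\<lambda>x. exponential_mixture x *\<^sub>R complex_of_real (sgn x / (1 + x\<^sup>2)))
      = (\<lambda>x. complex_of_real (exponential_mixture x * (sgn x / (1 + x\<^sup>2))))"
    by (simp add: fun_eq_iff scaleR_conv_of_real)
  finally show ?thesis unfolding complex_of_real_integrable_eq .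
qed

text \<open>
  The substitution \<open>x = u s\<close> turns the inner integral into Frullani's with \<open>z = - i t u\<close>.
\<close>
lemma levy_integral:
  shows "integrable lborel (\<lambda>x. exponential_mixture x *\<^sub>R ((iexp (t * x) - 1) / of_real \<bar>x\<bar>))"
    and "(\<integral>x. exponential_mixture x *\<^sub>R ((iexp (t * x) - 1) / of_real \<bar>x\<bar>) \<partial>lborel) = - log_exponent t"
proof -
  let ?h = "\<lambda>x. (iexp (t * x) - 1) / of_real \<bar>x\<bar>"
  have h: "\<bar>x\<bar> * norm (?h x) \<le> 4 * (1 - exp (- (\<bar>t\<bar> * \<bar>x\<bar>)))" for x
  proof (cases "x = 0")
    case False
    have "norm (1 - exp (- (- (\<i> * of_real (t * x))))) \<le> 4 * (1 - exp (- norm (- (\<i> * of_real (t * x)))))"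
      by (rule norm_one_minus_exp_le) simp
    then show ?thesis using False by (simp add: norm_divide norm_mult abs_mult norm_minus_commute)
  qed simp
  note * = integral_exponential_mixture[of ?h "\<bar>t\<bar>" 4, OF _ _ h]
  show "integrable lborel (\<lambda>x. exponential_mixture x *\<^sub>R ?h x)" by (rule *(1)) auto
  have "(\<integral>x. exponential_mixture x *\<^sub>R ?h x \<partial>lborel)
      = (\<integral>u. \<integral>s. (indicator {0<..} s * exp (- s)) *\<^sub>R (of_real \<bar>u\<bar> * ?h (u * s)) \<partial>lborel \<partial>\<alpha>)"
    by (rule *(2)) auto
  also have "\<dots> = (\<integral>u. - Ln (1 - \<i> * of_real (t * u)) \<partial>\<alpha>)"
  proof (intro Bochner_Integration.integral_cong refl)
    fix u
    have "(indicator {0<..} s * exp (- s)) *\<^sub>R (of_real \<bar>u\<bar> * ?h (u * s)) = - frullani_integrand (- (\<i> * of_real (t * u))) s" for s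
    proof (cases "s > 0 \<and> u \<noteq> 0")
      case True
      then show ?thesis
        by (simp add: frullani_integrand_def scaleR_conv_of_real abs_mult field_simps)
    qed (auto simp: frullani_integrand_def)
    then have "(\<integral>s. (indicator {0<..} s * exp (- s)) *\<^sub>R (of_real \<bar>u\<bar> * ?h (u * s)) \<partial>lborel)
        = - (\<integral>s. frullani_integrand (- (\<i> * of_real (t * u))) s \<partial>lborel)"
      by (simp only: Bochner_Integration.integral_minus)
    also have "\<dots> = - Ln (1 + - (\<i> * of_real (t * u)))"
      by (subst frullani(2)) (auto intro: half_plane)
    finally show "(\<integral>s. (indicator {0<..} s * exp (- s)) *\<^sub>R (of_real \<bar>u\<bar> * ?h (u * s)) \<partial>lborel)
        = - Ln (1 - \<i> * of_real (t * u))" by simp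
  qed
  also have "\<dots> = - log_exponent t" by (simp add: log_exponent_def)
  finally show "(\<integral>x. exponential_mixture x *\<^sub>R ?h x \<partial>lborel) = - log_exponent t" .
qed

lemma g_density_nonneg: "g_density \<alpha> x \<ge> 0"
  by (simp add: g_density_eq exponential_mixture_nonneg)

lemma finite_borel_measure_g: "finite_borel_measure (density lborel (\<lambda>x. ennreal (g_density \<alpha> x)))"
proof (intro finite_borel_measure.intro finite_measureI finite_borel_measure_axioms.intro)
  have [measurable]: "g_density \<alpha> \<in> borel_measurable borel"
    using integrable_g_density by simp
  have "emeasure (density lborel (\<lambda>x. ennreal (g_density \<alpha> x))) UNIV = ennreal (\<integral>x. g_density \<alpha> x \<partial>lborel)"
    by (simp add: emeasure_density nn_integral_eq_integral[OF integrable_g_density] g_density_nonneg)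
  then show "emeasure (density lborel (\<lambda>x. ennreal (g_density \<alpha> x))) (space (density lborel (\<lambda>x. ennreal (g_density \<alpha> x)))) \<noteq> \<infinity>"
    by simp
qed simp

lemma cdf_g: "(LBINT y:{..x}. g_density \<alpha> y) = cdf (density lborel (\<lambda>x. ennreal (g_density \<alpha> x))) x"
proof -
  have [measurable]: "g_density \<alpha> \<in> borel_measurable borel"
    using integrable_g_density by simp
  interpret finite_borel_measure "density lborel (\<lambda>x. ennreal (g_density \<alpha> x))" by (rule finite_borel_measure_g)
  have int: "integrable lborel (\<lambda>y. indicator {..x} y *\<^sub>R g_density \<alpha> y)"
    using integrable_g_density by (intro integrable_mult_indicator) auto
  have "emeasure (density lborel (\<lambda>x. ennreal (g_density \<alpha> x))) {..x} = (\<integral>\<^sup>+y. ennreal (indicator {..x} y *\<^sub>R g_density \<alpha> y) \<partial>lborel)"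
    by (subst emeasure_density) (auto intro!: nn_integral_cong split: split_indicator)
  also have "\<dots> = ennreal (LBINT y:{..x}. g_density \<alpha> y)"
    unfolding set_lebesgue_integral_def
    by (rule nn_integral_eq_integral[OF int]) (simp add: g_density_nonneg)
  finally show ?thesis
    by (simp add: cdf_def2 measure_def set_lebesgue_integral_def integral_nonneg_AE g_density_nonneg)
qed

text \<open>
  Multiplying \<open>g\<close> by \<open>(1 + u\<^sup>2) / u\<^sup>2\<close> leaves the Levy density \<open>\<rho>(u) / |u|\<close>, and the compensating term
  contributes exactly \<open>- i t \<gamma>\<close>, because \<open>g(u) / u\<close> is itself integrable.
\<close>
theorem levy_khintchine_log_exponent:
  "levy_khintchine_representation (\<lambda>t. exp (- log_exponent t))
        (LBINT x:UNIV - {0}. inverse x * g_density \<alpha> x)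
        (\<lambda>x. LBINT y:{..x}. g_density \<alpha> y)"
proof -
  define \<mu> where "\<mu> = density lborel (\<lambda>x. ennreal (g_density \<alpha> x))"
  define \<gamma> where "\<gamma> = (LBINT x:UNIV - {0}. inverse x * g_density \<alpha> x)"
  have [measurable]: "g_density \<alpha> \<in> borel_measurable borel"
    using integrable_g_density by simp
  interpret \<mu>: finite_borel_measure \<mu> unfolding \<mu>_def by (rule finite_borel_measure_g)
  have \<gamma>: "\<gamma> = (\<integral>x. exponential_mixture x * (sgn x / (1 + x\<^sup>2)) \<partial>lborel)"
    unfolding \<gamma>_def set_lebesgue_integral_def centering_integrand_eq ..
  have "(CLINT u:UNIV - {0}|\<mu>. (iexp (t * u) - 1 - \<i> * t * u / (1 + u\<^sup>2)) * ((1 + u\<^sup>2) / u\<^sup>2))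
      = - log_exponent t - \<i> * t * \<gamma>" for t
  proof -
    have pt: "g_density \<alpha> u *\<^sub>R (indicator (UNIV - {0}) u *\<^sub>R
        ((iexp (t * u) - 1 - \<i> * t * u / (1 + u\<^sup>2)) * ((1 + u\<^sup>2) / u\<^sup>2)))
      = exponential_mixture u *\<^sub>R ((iexp (t * u) - 1) / of_real \<bar>u\<bar>)
        - (\<i> * t) * of_real (exponential_mixture u * (sgn u / (1 + u\<^sup>2)))" for u
    proof (cases "u = 0")
      case False
      have "1 + u\<^sup>2 > 0" by (intro add_pos_nonneg) auto
      then have nz: "complex_of_real (1 + u\<^sup>2) \<noteq> 0" "complex_of_real \<bar>u\<bar> \<noteq> 0" "complex_of_real u \<noteq> 0" using False by (auto simp del: of_real_add)
      have sq: "complex_of_real u * complex_of_real u = complex_of_real \<bar>u\<bar> * complex_of_real \<bar>u\<bar>"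
        by (simp flip: of_real_mult)
      have sg: "complex_of_real u = complex_of_real (sgn u) * complex_of_real \<bar>u\<bar>"
        by (simp flip: of_real_mult add: sgn_mult_abs)
      \<comment> \<open>Abstracting the nonzero factors leaves an identity of rational functions.\<close>
      define d where "d = complex_of_real (1 + u\<^sup>2)"
      define b where "b = complex_of_real \<bar>u\<bar>"
      define E where "E = iexp (t * u) - 1"
      define \<rho> where "\<rho> = complex_of_real (exponential_mixture u)"
      have "b / d * \<rho> * ((E - \<i> * t * (of_real (sgn u) * b) / d) * (d / (b * b)))
          = \<rho> * (E / b) - \<i> * t * (\<rho> * (of_real (sgn u) / d))"
        using nz unfolding d_def[symmetric] b_def[symmetric] by (simp add: field_simps)
      then show ?thesis
        using False unfolding g_density_eq d_def b_def E_def \<rho>_def sg[symmetric] sq[symmetric]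
        by (simp add: scaleR_conv_of_real power2_eq_square)
    qed simp
    have "(CLINT u:UNIV - {0}|\<mu>. (iexp (t * u) - 1 - \<i> * t * u / (1 + u\<^sup>2)) * ((1 + u\<^sup>2) / u\<^sup>2))
       = (\<integral>u. g_density \<alpha> u *\<^sub>R (indicator (UNIV - {0}) u *\<^sub>R
        ((iexp (t * u) - 1 - \<i> * t * u / (1 + u\<^sup>2)) * ((1 + u\<^sup>2) / u\<^sup>2))) \<partial>lborel)"
      unfolding set_lebesgue_integral_def \<mu>_def
      by (rule integral_density) (auto simp: g_density_nonneg)
    also have "\<dots> = - log_exponent t - (\<i> * t) * (\<integral>u. of_real (exponential_mixture u * (sgn u / (1 + u\<^sup>2))) \<partial>lborel)"
      unfolding pt using levy_integral[of t] integrable_centering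
      by (subst Bochner_Integration.integral_diff)
         (simp_all only: complex_of_real_integrable_eq integrable_mult_right Bochner_Integration.integral_mult_right_zero)
    also have "(\<integral>u. complex_of_real (exponential_mixture u * (sgn u / (1 + u\<^sup>2))) \<partial>lborel) = of_real \<gamma>"
      unfolding \<gamma> by (rule integral_complex_of_real)
    finally show ?thesis .
  qed
  note levy = this
  have G: "(\<lambda>x. LBINT y:{..x}. g_density \<alpha> y) = cdf \<mu>"
    by (simp add: cdf_g \<mu>_def)
  show ?thesis
    unfolding levy_khintchine_representation_def G \<gamma>_def[symmetric] \<mu>.interval_measure_cdf levy
    using \<mu>.cdf_nondecreasing \<mu>.cdf_is_right_cont \<mu>.cdf_lim_at_bot \<mu>.cdf_lim_at_top
    by (auto simp: mono_def)
qed

text \<open>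
  \<open>|exp (- K(1))| = 1\<close> already forces \<open>\<integral> ln (1 + x\<^sup>2) / 2 d\<alpha> = 0\<close>.
\<close>
lemma exp_log_exponent_eq_one_iff:
  "(\<forall>t. exp (- log_exponent t) = 1) \<longleftrightarrow> (AE x in \<alpha>. x = 0)"
proof
  assume "AE x in \<alpha>. x = 0"
  then have "log_exponent t = (\<integral>x. 0 \<partial>\<alpha>)" for t
    unfolding log_exponent_def
    by (intro integral_cong_AE) (auto elim!: eventually_mono)
  then show "\<forall>t. exp (- log_exponent t) = 1" by simp
next
  assume "\<forall>t. exp (- log_exponent t) = 1"
  then have "norm (exp (- log_exponent 1)) = 1" by simp
  then have Re0: "Re (log_exponent 1) = 0" by simp
  have int: "integrable \<alpha> (\<lambda>x. Ln (1 - \<i> * of_real (1 * x)))"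
  proof (rule Bochner_Integration.integrable_bound)
    show "integrable \<alpha> (\<lambda>x. 4 * ln (1 + \<bar>x\<bar>))" using integrable_log by simp
    show "AE x in \<alpha>. norm (Ln (1 - \<i> * of_real (1 * x))) \<le> norm (4 * ln (1 + \<bar>x\<bar>))"
    proof (rule AE_I2)
      fix x
      show "norm (Ln (1 - \<i> * of_real (1 * x))) \<le> norm (4 * ln (1 + \<bar>x\<bar>))"
        using norm_Ln_le[of "- (\<i> * of_real x)"] by (simp add: norm_mult)
    qed
  qed measurable
  have Re_Ln: "Re (Ln (1 - \<i> * of_real (1 * x))) = ln (1 + x\<^sup>2) / 2" for x :: real
  proof -
    have "1 - \<i> * of_real (1 * x) \<noteq> 0" by (simp add: complex_eq_iff)
    then have "Re (Ln (1 - \<i> * of_real (1 * x))) = ln (norm (1 - \<i> * of_real (1 * x)))" by (rule Re_Ln)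
    also have "\<dots> = ln (sqrt (1 + x\<^sup>2))" by (simp add: cmod_def)
    also have "\<dots> = ln (1 + x\<^sup>2) / 2" by (rule ln_sqrt) (simp add: add_pos_nonneg)
    finally show ?thesis .
  qed
  have "(\<integral>x. Re (Ln (1 - \<i> * of_real (1 * x))) \<partial>\<alpha>) = 0"
    using Re0 integral_Re[OF int] by (simp add: log_exponent_def)
  moreover have "integrable \<alpha> (\<lambda>x. Re (Ln (1 - \<i> * of_real (1 * x))))" by (rule integrable_Re[OF int])
  ultimately have "AE x in \<alpha>. ln (1 + x\<^sup>2) / 2 = 0"
    unfolding Re_Ln by (subst (asm) integral_nonneg_eq_0_iff_AE) auto
  then show "AE x in \<alpha>. x = 0"
  proof eventually_elim
    case (elim x)
    have "1 + x\<^sup>2 > 0" by (simp add: add_pos_nonneg)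
    then show "x = 0" using elim by simp
  qed
qed

lemma concentrated_at_zero_iff:
  "(AE x in \<alpha>. x = 0) \<longleftrightarrow> \<alpha> = scale_measure (ennreal (measure \<alpha> UNIV)) (return borel 0)"
proof
  assume ae: "AE x in \<alpha>. x = 0"
  show "\<alpha> = scale_measure (ennreal (measure \<alpha> UNIV)) (return borel 0)"
  proof (rule measure_eqI)
    fix A assume "A \<in> sets \<alpha>"
    then have A: "A \<in> sets borel" by simp
    have "emeasure \<alpha> A = emeasure \<alpha> (if 0 \<in> A then UNIV else {})"
      using ae A by (intro emeasure_eq_AE) (auto elim!: eventually_mono)
    also have "\<dots> = emeasure (scale_measure (ennreal (measure \<alpha> UNIV)) (return borel 0)) A"
      using A by (simp add: emeasure_eq_measure)
    finally show "emeasure \<alpha> A = emeasure (scale_measure (ennreal (measure \<alpha> UNIV)) (return borel 0)) A" .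
  qed simp
next
  assume eq: "\<alpha> = scale_measure (ennreal (measure \<alpha> UNIV)) (return borel 0)"
  have "emeasure \<alpha> (UNIV - {0}) = 0"
    by (subst eq) simp
  then show "AE x in \<alpha>. x = 0"
    by (intro AE_I[where N = "UNIV - {0}"]) auto
qed

end

theorem theorem3:
  fixes M :: "'w measure" and \<alpha> :: "real measure" and \<xi> :: "'w \<Rightarrow> real measure" and a :: real
  assumes "finite_measure \<alpha>" and "sets \<alpha> = sets borel"
    and "a = measure \<alpha> UNIV" and "a > 0"
    and "integrable \<alpha> (\<lambda>x. ln (1 + \<bar>x\<bar>))"
    and "gamma_process M \<alpha> \<xi>"
  shows "(AE \<omega> in M. integrable (\<xi> \<omega>) (\<lambda>x. x))
    \<and> integrable lborel (g_density \<alpha>)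
    \<and> set_integrable lborel (UNIV - {0}) (\<lambda>x. inverse x * g_density \<alpha> x)
    \<and> infinitely_divisible_cf (identity_integral_cf M \<xi>)
    \<and> levy_khintchine_representation (identity_integral_cf M \<xi>)
        (LBINT x:UNIV - {0}. inverse x * g_density \<alpha> x)
        (\<lambda>x. LBINT y:{..x}. g_density \<alpha> y)
    \<and> ((\<forall>t. identity_integral_cf M \<xi> t = 1) \<longleftrightarrow> \<alpha> = scale_measure (ennreal a) (return borel 0))"
proof -
  interpret \<alpha>: log_finite_measure \<alpha>
    using assms by (simp add: log_finite_measure_def log_finite_measure_axioms_def)
  interpret G: log_gamma_process M \<alpha> \<xi>
    using assms(6) \<alpha>.log_finite_measure_axioms by (simp add: log_gamma_process_def)
  have cf: "identity_integral_cf M \<xi> = (\<lambda>t. exp (- \<alpha>.log_exponent t))"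
    using G.identity_integral_cf_eq by auto
  have "infinitely_divisible_cf (identity_integral_cf M \<xi>)"
    unfolding infinitely_divisible_cf_def
  proof (intro allI impI)
    fix n :: nat assume n: "n \<ge> 1"
    obtain \<mu> where \<mu>: "real_distribution \<mu>" "char \<mu> = (\<lambda>t. exp (- of_real (1 / real n) * \<alpha>.log_exponent t))"
      using \<alpha>.exists_char_exp_log_exponent[of "1 / real n"] by auto
    have "identity_integral_cf M \<xi> t = char \<mu> t ^ n" for t
      using n by (simp add: cf \<mu>(2) exp_of_nat_mult[symmetric])
    with \<mu>(1) show "\<exists>\<mu>. real_distribution \<mu> \<and> (\<forall>t. identity_integral_cf M \<xi> t = char \<mu> t ^ n)" by blast
  qed
  moreover have "set_integrable lborel (UNIV - {0}) (\<lambda>x. inverse x * g_density \<alpha> x)"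
    unfolding set_integrable_def \<alpha>.centering_integrand_eq by (rule \<alpha>.integrable_centering)
  ultimately show ?thesis
    using G.AE_integrable_identity \<alpha>.integrable_g_density \<alpha>.levy_khintchine_log_exponent
      \<alpha>.exp_log_exponent_eq_one_iff \<alpha>.concentrated_at_zero_iff
    by (simp only: cf assms(3) simp_thms)
qed

end
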